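(* If $X\in 2^\omega$ is Demuth random and $G\in 2^\omega$ is pb-generic, then $X$ and $G$ form a minimal pair in the Turing degrees.
   Context: $2^\omega$ is the Cantor space of infinite binary sequences, $2^{<\omega}$ is the set of finite binary strings, $\preceq$ is the prefix relation, and $G\upharpoonright n$ is the prefix of $G$ of length $n$. $\mu$ is the Lebesgue (uniform) measure on $2^\omega$, determined by $\mu([\sigma])=2^{-|\sigma|}$ for every $\sigma\in 2^{<\omega}$, where $[\sigma]$ is the set of $X\in 2^\omega$ having $\sigma$ as a prefix. An open set is effectively open if it is of the form $\bigcup_{\sigma\in S}[\sigma]$ for a computably enumerable set $S$ of strings. Fix an effective enumeration $(\mathcal{W}_e)_{e\in\omega}$ of all effectively open subsets of $2^\omega$. A function $g:\omega\to\omega$ is $\omega$-c.a. if it has a computable approximation $g(n,s)$ (so $\lim_s g(n,s)=g(n)$ for all $n$) and there is a computable function $h$ such that for every $n$ the number of $s$ with $g(n,s)\neq g(n,s+1)$ is at most $h(n)$. A Demuth test is a sequence $(\mathcal{W}_{g(n)})_{n\in\omega}$ where $g$ is an $\omega$-c.a. function and $\mu(\mathcal{W}_{g(n)})\leq 2^{-n}$ for all $n$. $X\in 2^\omega$ is Demuth random if for every Demuth test $(\mathcal{W}_{g(n)})_{n\in\omega}$, $X$ belongs to only finitely many of the sets $\mathcal{W}_{g(n)}$. $G\in 2^\omega$ is pb-generic if for every function $f:2^{<\omega}\to 2^{<\omega}$ such that (i) $f$ is computable in $\emptyset'$ with a primitive recursive bound on the use (strings being identified with integers via a fixed primitive recursive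 bijection), and (ii) $\sigma\preceq f(\sigma)$ for all $\sigma$, there are infinitely many $n$ such that $f(G\upharpoonright n)\preceq G$. $X$ and $G$ form a minimal pair in the Turing degrees if both are non-computable and every $Z\in 2^\omega$ that is Turing computable from $X$ and also Turing computable from $G$ is computable. *)

theory Defs
  imports "HOL-Probability.Probability" "HOL-Library.Nat_Bijection" "HOL-Library.Sublist"
    "HOL-Library.Monad_Syntax"
begin

text \<open>
  Kleene's partial recursive functions relative to an oracle, in unary form: tuples of arguments
  are packed with the Cantor pairing function \<^const>\<open>prod_encode\<close>, with projections
  \<open>Fst\<close> and \<open>Snd\<close>. (The identity is \<open>Tuple Fst Snd\<close>, because the pairing is onto.)
\<close>

datatype prog =
    Zero
  | Succ
  | Fst
  | Snd
  | Query
  | Tuple prog prog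
  | Compose prog prog
  | PrimRec prog prog
  | Mu prog

text \<open>
  Oracles are partial functions: a computation that queries the oracle where it is undefined has
  no value. Oracles of interest are characteristic functions of sets (total), and their
  restrictions to initial segments, which express bounds on the use.
\<close>

primrec eval :: "(nat \<rightharpoonup> nat) \<Rightarrow> prog \<Rightarrow> nat \<rightharpoonup> nat" where
  "eval A Zero = (\<lambda>x. Some 0)"
| "eval A Succ = (\<lambda>x. Some (x + 1))"
| "eval A Fst = (\<lambda>x. Some (fst (prod_decode x)))"
| "eval A Snd = (\<lambda>x. Some (snd (prod_decode x)))"
| "eval A Query = A"
| "eval A (Tuple p q) =
     (\<lambda>x. do { a \<leftarrow> eval A p x; b \<leftarrow> eval A q x; Some (prod_encode (a, b)) })"
| "eval A (Compose p q) = (\<lambda>x. do { y \<leftarrow> eval A q x; eval A p y })"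
| "eval A (PrimRec p q) = (\<lambda>x. case prod_decode x of (a, n) \<Rightarrow>
     rec_nat (eval A p a)
       (\<lambda>m r. do { v \<leftarrow> r; eval A q (prod_encode (a, prod_encode (m, v))) }) n)"
| "eval A (Mu p) = (\<lambda>x.
     if \<exists>n. eval A p (prod_encode (x, n)) = Some 0 \<and> (\<forall>m<n. eval A p (prod_encode (x, m)) \<noteq> None)
     then Some (LEAST n. eval A p (prod_encode (x, n)) = Some 0)
     else None)"

primrec prog_code :: "prog \<Rightarrow> nat" where
  "prog_code Zero = 0"
| "prog_code Succ = 1"
| "prog_code Fst = 2"
| "prog_code Snd = 3"
| "prog_code Query = 4"
| "prog_code (Tuple p q) = 5 + 4 * prod_encode (prog_code p, prog_code q)"
| "prog_code (Compose p q) = 6 + 4 * prod_encode (prog_code p, prog_code q)"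
| "prog_code (PrimRec p q) = 7 + 4 * prod_encode (prog_code p, prog_code q)"
| "prog_code (Mu p) = 8 + 4 * prog_code p"

definition prog_of :: "nat \<Rightarrow> prog" where
  "prog_of = inv prog_code"

lemma inj_prog_code: "inj prog_code"
proof (rule injI)
  fix p q :: prog
  show "prog_code p = prog_code q \<Longrightarrow> p = q"
  proof (induction p arbitrary: q)
    case Zero then show ?case by (cases q) simp_all
  next
    case Succ then show ?case by (cases q) simp_all
  next
    case Fst then show ?case by (cases q) simp_all
  next
    case Snd then show ?case by (cases q) simp_all
  next
    case Query then show ?case by (cases q) simp_all
  next
    case (Tuple p1 p2)
    then show ?case by (cases q) (simp_all, presburger+)
  next
    case (Compose p1 p2)
    then show ?case by (cases q) (simp_all, presburger+)
  next
    case (PrimRec p1 p2)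
    then show ?case by (cases q) (simp_all, presburger+)
  next
    case (Mu p)
    then show ?case by (cases q) (simp_all, presburger+)
  qed
qed

lemma surj_prog_code: "surj prog_code"
proof -
  have "n \<in> range prog_code" for n
  proof (induction n rule: less_induct)
    case (less n)
    show ?case
    proof (cases "n < 5")
      case True
      then have "n = prog_code Zero \<or> n = prog_code Succ \<or> n = prog_code Fst
          \<or> n = prog_code Snd \<or> n = prog_code Query" by auto
      then show ?thesis by blast
    next
      case False
      define k where "k = (n - 5) div 4"
      obtain a b where ab: "k = prod_encode (a, b)"
        by (metis prod.exhaust prod_decode_inverse)
      have "a \<le> k" "b \<le> k"
        by (auto simp: ab le_prod_encode_1 le_prod_encode_2)
      moreover have "k < n" using False by (auto simp: k_def)
      ultimately have "a \<in> range prog_code" "b \<in> range prog_code" "k \<in> range prog_code"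
        using less by auto
      then obtain p q r where pqr: "a = prog_code p" "b = prog_code q" "k = prog_code r"
        by blast
      have "n = 5 + 4 * k \<or> n = 6 + 4 * k \<or> n = 7 + 4 * k \<or> n = 8 + 4 * k"
        using False unfolding k_def by presburger
      then have "n = prog_code (Tuple p q) \<or> n = prog_code (Compose p q)
          \<or> n = prog_code (PrimRec p q) \<or> n = prog_code (Mu r)"
        using ab pqr by auto
      then show ?thesis by blast
    qed
  qed
  then show ?thesis by blast
qed

lemma prog_of_prog_code [simp]: "prog_of (prog_code p) = p"
  and prog_code_prog_of [simp]: "prog_code (prog_of e) = e"
  by (simp_all add: prog_of_def inj_prog_code surj_prog_code surj_f_inv_f)

type_synonym cantor = "nat \<Rightarrow> bool"

definition oracle_of :: "cantor \<Rightarrow> nat \<rightharpoonup> nat" where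
  "oracle_of X n = Some (of_bool (X n))"

text \<open>
  Unrelativized computation is computation with oracle \<open>\<emptyset>\<close>.
\<close>

abbreviation empty_oracle :: "nat \<rightharpoonup> nat" where
  "empty_oracle \<equiv> oracle_of (\<lambda>_. False)"

definition computable :: "(nat \<Rightarrow> nat) \<Rightarrow> bool" where
  "computable f \<longleftrightarrow> (\<exists>p. \<forall>x. eval empty_oracle p x = Some (f x))"

definition computable2 :: "(nat \<Rightarrow> nat \<Rightarrow> nat) \<Rightarrow> bool" where
  "computable2 f \<longleftrightarrow> (\<exists>p. \<forall>x y. eval empty_oracle p (prod_encode (x, y)) = Some (f x y))"

definition ce :: "nat set \<Rightarrow> bool" where
  "ce S \<longleftrightarrow> (\<exists>p. S = dom (eval empty_oracle p))"

primrec primitive :: "prog \<Rightarrow> bool" where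
  "primitive Zero = True"
| "primitive Succ = True"
| "primitive Fst = True"
| "primitive Snd = True"
| "primitive Query = False"
| "primitive (Tuple p q) = (primitive p \<and> primitive q)"
| "primitive (Compose p q) = (primitive p \<and> primitive q)"
| "primitive (PrimRec p q) = (primitive p \<and> primitive q)"
| "primitive (Mu p) = False"

definition primitive_recursive :: "(nat \<Rightarrow> nat) \<Rightarrow> bool" where
  "primitive_recursive f \<longleftrightarrow> (\<exists>p. primitive p \<and> (\<forall>x. eval empty_oracle p x = Some (f x)))"

definition turing_le :: "cantor \<Rightarrow> cantor \<Rightarrow> bool"  (infix "\<le>\<^sub>T" 50) where
  "Z \<le>\<^sub>T X \<longleftrightarrow> (\<exists>p. \<forall>n. eval (oracle_of X) p n = Some (of_bool (Z n)))"

definition computable_seq :: "cantor \<Rightarrow> bool" where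
  "computable_seq Z \<longleftrightarrow> computable (\<lambda>n. of_bool (Z n))"

text \<open>\<open>\<emptyset>'\<close>, the set of all \<open>e\<close> such that the \<open>e\<close>-th program halts on input \<open>e\<close>.\<close>

definition zero_jump :: cantor where
  "zero_jump e \<longleftrightarrow> eval empty_oracle (prog_of e) e \<noteq> None"


text \<open>
  Strings are identified with integers in length-lexicographic order: \<open>str_code \<sigma> + 1\<close> is the
  number with binary expansion \<open>1\<sigma>\<close>.
\<close>

definition str_code :: "bool list \<Rightarrow> nat" where
  "str_code \<sigma> = foldl (\<lambda>n b. 2 * n + (if b then 2 else 1)) 0 \<sigma>"

lemma str_code_Nil [simp]: "str_code [] = 0"
  by (simp add: str_code_def)

lemma str_code_snoc [simp]:
  "str_code (\<sigma> @ [b]) = 2 * str_code \<sigma> + (if b then 2 else 1)"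
  by (simp add: str_code_def)

lemma bij_str_code: "bij str_code"
proof (rule bijI)
  show "inj str_code"
  proof (rule injI)
    fix \<sigma> \<tau> :: "bool list"
    show "str_code \<sigma> = str_code \<tau> \<Longrightarrow> \<sigma> = \<tau>"
    proof (induction \<sigma> arbitrary: \<tau> rule: rev_induct)
      case Nil
      then show ?case by (cases \<tau> rule: rev_cases) (auto split: if_splits)
    next
      case (snoc b \<sigma>)
      show ?case
      proof (cases \<tau> rule: rev_cases)
        case Nil
        then show ?thesis using snoc.prems by (auto split: if_splits)
      next
        case (snoc \<tau>' c)
        then have eq: "2 * str_code \<sigma> + (if b then 2 else 1)
            = 2 * str_code \<tau>' + (if c then 2 else 1)"
          using snoc.prems by simp
        then have "b = c" by (cases b; cases c; simp; presburger)
        with eq snoc snoc.IH[of \<tau>'] show ?thesis by simp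
      qed
    qed
  qed
  have "n \<in> range str_code" for n
  proof (induction n rule: less_induct)
    case (less n)
    show ?case
    proof (cases "n = 0")
      case True
      then show ?thesis by (metis rangeI str_code_Nil)
    next
      case False
      then obtain \<sigma> where \<sigma>: "(n - 1) div 2 = str_code \<sigma>"
        using less[of "(n - 1) div 2"] by fastforce
      have "n = 2 * ((n - 1) div 2) + (if even n then 2 else 1)"
        using False by presburger
      then have "n = str_code (\<sigma> @ [even n])"
        using \<sigma> by simp
      then show ?thesis by blast
    qed
  qed
  then show "surj str_code" by blast
qed

definition restr :: "cantor \<Rightarrow> nat \<Rightarrow> bool list"  (infixl "\<restriction>" 75) where
  "X \<restriction> n = map X [0..<n]"

definition cylinder :: "bool list \<Rightarrow> cantor set" where
  "cylinder \<sigma> = {X. X \<restriction> length \<sigma> = \<sigma>}"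

definition cantor_measure :: "cantor measure" where
  "cantor_measure = PiM UNIV (\<lambda>_. measure_pmf (bernoulli_pmf (1 / 2)))"

lemma restr_eq_iff: "X \<restriction> length \<sigma> = \<sigma> \<longleftrightarrow> (\<forall>i<length \<sigma>. X i = \<sigma> ! i)"
proof -
  have "X \<restriction> length \<sigma> = \<sigma> \<longleftrightarrow> length (X \<restriction> length \<sigma>) = length \<sigma> \<and> (\<forall>i<length (X \<restriction> length \<sigma>). (X \<restriction> length \<sigma>) ! i = \<sigma> ! i)"
    by (rule list_eq_iff_nth_eq)
  also have "\<dots> \<longleftrightarrow> (\<forall>i<length \<sigma>. X i = \<sigma> ! i)" by (simp add: restr_def)
  finally show ?thesis .
qed

lemma cylinder_emb:
  "cylinder \<sigma> = prod_emb UNIV (\<lambda>_. measure_pmf (bernoulli_pmf (1 / 2))) {..<length \<sigma>}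
      (Pi\<^sub>E {..<length \<sigma>} (\<lambda>i. {\<sigma> ! i}))"
proof -
  have "X \<in> cylinder \<sigma> \<longleftrightarrow> X \<in> prod_emb UNIV (\<lambda>_. measure_pmf (bernoulli_pmf (1 / 2))) {..<length \<sigma>}
      (Pi\<^sub>E {..<length \<sigma>} (\<lambda>i. {\<sigma> ! i}))" for X
    unfolding cylinder_def restr_eq_iff prod_emb_def by (simp add: PiE_iff Ball_def)
  then show ?thesis by blast
qed
lemma space_cantor_measure [simp]: "space cantor_measure = UNIV"
  by (simp add: cantor_measure_def space_PiM)

lemma sets_cylinder [measurable]: "cylinder \<sigma> \<in> sets cantor_measure"
  unfolding cantor_measure_def cylinder_emb by (rule sets_PiM_I) simp_all

lemma measure_cylinder: "measure cantor_measure (cylinder \<sigma>) = (1 / 2) ^ length \<sigma>"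
proof -
  interpret product_prob_space "\<lambda>_. measure_pmf (bernoulli_pmf (1 / 2))" "UNIV :: nat set"
    by unfold_locales
  have "measure cantor_measure (cylinder \<sigma>)
      = (\<Prod>i<length \<sigma>. measure (measure_pmf (bernoulli_pmf (1 / 2))) {\<sigma> ! i})"
    unfolding cantor_measure_def cylinder_emb by (rule measure_PiM_emb) simp_all
  also have "\<dots> = (1 / 2) ^ length \<sigma>" by (simp only: measure_pmf_single pmf_bernoulli_half) simp
  finally show ?thesis .
qed

definition effectively_open :: "cantor set \<Rightarrow> bool" where
  "effectively_open U \<longleftrightarrow> (\<exists>S. ce (str_code ` S) \<and> U = (\<Union>\<sigma>\<in>S. cylinder \<sigma>))"

definition eff_open :: "nat \<Rightarrow> cantor set"  ("\<W>") where
  "\<W> e = (\<Union>\<sigma> \<in> {\<sigma>. eval empty_oracle (prog_of e) (str_code \<sigma>) \<noteq> None}. cylinder \<sigma>)"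

lemma range_eff_open: "range \<W> = {U. effectively_open U}"
proof -
  define D where "D p = {\<sigma>. eval empty_oracle p (str_code \<sigma>) \<noteq> None}" for p
  have \<W>: "\<W> e = (\<Union>\<sigma>\<in>D (prog_of e). cylinder \<sigma>)" for e
    by (simp add: eff_open_def D_def)
  have "D p = str_code -` dom (eval empty_oracle p)" for p
    by (simp only: D_def dom_def vimage_Collect_eq)
  then have D: "str_code ` S = dom (eval empty_oracle p) \<longleftrightarrow> S = D p" for S p
    using bij_str_code
    by (metis bij_is_inj bij_is_surj inj_vimage_image_eq surj_image_vimage_eq)
  show ?thesis
  proof (intro equalityI subsetI)
    fix U assume "U \<in> range \<W>"
    then obtain e where "U = (\<Union>\<sigma>\<in>D (prog_of e). cylinder \<sigma>)"
      using \<W> by (metis rangeE)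
    moreover have "ce (str_code ` D (prog_of e))"
      unfolding ce_def using D by metis
    ultimately show "U \<in> {U. effectively_open U}"
      unfolding effectively_open_def mem_Collect_eq by metis
  next
    fix U assume "U \<in> {U. effectively_open U}"
    then obtain p where "U = (\<Union>\<sigma>\<in>D p. cylinder \<sigma>)"
      unfolding effectively_open_def ce_def mem_Collect_eq D by metis
    then have "U = \<W> (prog_code p)"
      by (simp only: \<W> prog_of_prog_code)
    then show "U \<in> range \<W>" by (rule range_eqI)
  qed
qed

lemma sets_eff_open [measurable]: "\<W> e \<in> sets cantor_measure"
  unfolding eff_open_def by (rule sets.countable_UN'') auto


definition omega_ca :: "(nat \<Rightarrow> nat) \<Rightarrow> bool" where
  "omega_ca g \<longleftrightarrow> (\<exists>a h. computable2 a \<and> computable h \<and>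
     (\<forall>n. \<forall>\<^sub>F s in sequentially. a n s = g n) \<and>
     (\<forall>n. finite {s. a n s \<noteq> a n (s + 1)} \<and> card {s. a n s \<noteq> a n (s + 1)} \<le> h n))"

definition demuth_test :: "(nat \<Rightarrow> cantor set) \<Rightarrow> bool" where
  "demuth_test U \<longleftrightarrow> (\<exists>g. omega_ca g \<and> (\<forall>n. U n = \<W> (g n))) \<and>
     (\<forall>n. measure cantor_measure (U n) \<le> (1 / 2) ^ n)"

definition demuth_random :: "cantor \<Rightarrow> bool" where
  "demuth_random X \<longleftrightarrow> (\<forall>U. demuth_test U \<longrightarrow> finite {n. X \<in> U n})"

text \<open>
  Restricting the oracle \<open>\<emptyset>'\<close> to the numbers below a bound makes every computation
  diverge that queries a number at or above the bound; so the condition says that \<open>p\<close> computes \<open>f\<close> from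
  \<open>\<emptyset>'\<close> and all queries made on input \<open>\<sigma>\<close> are below \<open>b\<close> at the code of \<open>\<sigma>\<close>.
\<close>

definition pb_computable :: "(bool list \<Rightarrow> bool list) \<Rightarrow> bool" where
  "pb_computable f \<longleftrightarrow> (\<exists>p b. primitive_recursive b \<and>
     (\<forall>\<sigma>. eval (oracle_of zero_jump |` {..<b (str_code \<sigma>)}) p (str_code \<sigma>)
          = Some (str_code (f \<sigma>))))"

definition pb_generic :: "cantor \<Rightarrow> bool" where
  "pb_generic G \<longleftrightarrow> (\<forall>f. pb_computable f \<and> (\<forall>\<sigma>. prefix \<sigma> (f \<sigma>)) \<longrightarrow>
     infinite {n. G \<in> cylinder (f (G \<restriction> n))})"

definition minimal_pair :: "cantor \<Rightarrow> cantor \<Rightarrow> bool" where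
  "minimal_pair X G \<longleftrightarrow> \<not> computable_seq X \<and> \<not> computable_seq G \<and>
     (\<forall>Z. Z \<le>\<^sub>T X \<and> Z \<le>\<^sub>T G \<longrightarrow> computable_seq Z)"

end

theory Submission
  imports Defs
begin

text \<open>
  Suppose that \<open>Z\<close> is computed by \<open>p\<close> from \<open>X\<close> and by \<open>q\<close> from \<open>G\<close>, and let \<open>n\<close> be the code of a string
  \<open>\<sigma>\<close>. Search for \<open>2\<^sup>n + 1\<close> extensions of \<open>\<sigma>\<close> on which \<open>q\<close> gives pairwise incompatible outputs. If they are
  found, the classes of all \<open>Y\<close> for which \<open>p\<close> with oracle \<open>Y\<close> agrees with one of these outputs are disjoint, so
  one of the classes has measure at most \<open>2\<^sup>-\<^sup>n\<close>. That a class has larger measure is a \<open>\<Sigma>\<^sub>1\<close> event,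
  so the first light class can be approximated with at most \<open>2\<^sup>n\<close> changes, and the light classes form a
  Demuth test; moreover \<open>\<emptyset>'\<close> finds the corresponding extension of \<open>\<sigma>\<close> with a primitive recursive bound
  on the use, because the queries depend only on \<open>n\<close> and on the number of the class. If \<open>Z\<close> is not computable,
  the search succeeds for every initial segment \<open>\<sigma>\<close> of \<open>G\<close>. As \<open>G\<close> is pb-generic, it extends infinitely many of
  the chosen strings, and then \<open>X\<close> lies in infinitely many members of the test.
\<close>

section \<open>Primitive recursive functions\<close>

abbreviation p1 :: "nat \<Rightarrow> nat" where "p1 x \<equiv> fst (prod_decode x)"
abbreviation p2 :: "nat \<Rightarrow> nat" where "p2 x \<equiv> snd (prod_decode x)"

text \<open>Without \<open>Query\<close> and \<open>Mu\<close> a program never sees its oracle and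
  never diverges. Hence one program for a primitive recursive function serves under every oracle,
  also under truncations of \<open>zero_jump\<close>.\<close>

lemma primitive_total_oracle_independent:
  assumes "primitive p"
  shows "\<exists>f. \<forall>A x. eval A p x = Some (f x)"
  using assms
proof (induction p)
  case (Tuple p q)
  then obtain f g where "\<forall>A x. eval A p x = Some (f x)" "\<forall>A x. eval A q x = Some (g x)" by auto
  then have "\<forall>A x. eval A (Tuple p q) x = Some (prod_encode (f x, g x))" by simp
  then show ?case by (rule exI[of _ "\<lambda>x. prod_encode (f x, g x)"])
next
  case (Compose p q)
  then obtain f g where "\<forall>A x. eval A p x = Some (f x)" "\<forall>A x. eval A q x = Some (g x)" by auto
  then have "\<forall>A x. eval A (Compose p q) x = Some (f (g x))" by simp
  then show ?case by (rule exI[of _ "\<lambda>x. f (g x)"])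
next
  case (PrimRec p q)
  then obtain f g where fg: "\<forall>A x. eval A p x = Some (f x)" "\<forall>A x. eval A q x = Some (g x)" by auto
  have "rec_nat (eval A p a)
      (\<lambda>m r. do { v \<leftarrow> r; eval A q (prod_encode (a, prod_encode (m, v))) }) n
    = Some (rec_nat (f a) (\<lambda>m r. g (prod_encode (a, prod_encode (m, r)))) n)" for A a n
    by (induction n) (simp_all add: fg)
  then have "\<forall>A x. eval A (PrimRec p q) x
    = Some (rec_nat (f (p1 x)) (\<lambda>m r. g (prod_encode (p1 x, prod_encode (m, r)))) (p2 x))"
    by (simp add: case_prod_beta)
  then show ?case
    by (rule exI[of _ "\<lambda>x. rec_nat (f (p1 x)) (\<lambda>m r. g (prod_encode (p1 x, prod_encode (m, r)))) (p2 x)"])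
qed auto

lemma primitive_recursive_iff:
  "primitive_recursive f \<longleftrightarrow> (\<exists>p. primitive p \<and> (\<forall>A x. eval A p x = Some (f x)))"
proof
  assume "primitive_recursive f"
  then obtain p where p: "primitive p" "\<And>x. eval empty_oracle p x = Some (f x)"
    unfolding primitive_recursive_def by blast
  then obtain g where g: "\<And>A x. eval A p x = Some (g x)"
    using primitive_total_oracle_independent by blast
  have "g x = f x" for x using p(2)[of x] g[of empty_oracle x] by simp
  then show "\<exists>p. primitive p \<and> (\<forall>A x. eval A p x = Some (f x))" using p g by auto
next
  assume "\<exists>p. primitive p \<and> (\<forall>A x. eval A p x = Some (f x))"
  then show "primitive_recursive f" unfolding primitive_recursive_def by blast
qed

lemma primitive_recursive_progE:
  assumes "primitive_recursive f"
  obtains p where "\<And>A x. eval A p x = Some (f x)"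
  using assms unfolding primitive_recursive_iff by blast

lemma pr_comp:
  assumes "primitive_recursive f" "primitive_recursive g"
  shows "primitive_recursive (\<lambda>x. f (g x))"
proof -
  obtain p q where "primitive p" "primitive q"
    "\<And>A x. eval A p x = Some (f x)" "\<And>A x. eval A q x = Some (g x)"
    using assms unfolding primitive_recursive_iff by blast
  then have "primitive (Compose p q) \<and> (\<forall>A x. eval A (Compose p q) x = Some (f (g x)))" by simp
  then show ?thesis unfolding primitive_recursive_iff by (rule exI)
qed

lemma pr_pair:
  assumes "primitive_recursive f" "primitive_recursive g"
  shows "primitive_recursive (\<lambda>x. prod_encode (f x, g x))"
proof -
  obtain p q where "primitive p" "primitive q"
    "\<And>A x. eval A p x = Some (f x)" "\<And>A x. eval A q x = Some (g x)"
    using assms unfolding primitive_recursive_iff by blast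
  then have "primitive (Tuple p q)
    \<and> (\<forall>A x. eval A (Tuple p q) x = Some (prod_encode (f x, g x)))" by simp
  then show ?thesis unfolding primitive_recursive_iff by (rule exI)
qed

lemma pr_id: "primitive_recursive (\<lambda>x. x)"
proof -
  have "primitive (Tuple Fst Snd) \<and> (\<forall>A x. eval A (Tuple Fst Snd) x = Some x)" by simp
  then show ?thesis unfolding primitive_recursive_iff by (rule exI)
qed

lemma pr_Suc0: "primitive_recursive Suc"
proof -
  have "primitive Succ \<and> (\<forall>A x. eval A Succ x = Some (Suc x))" by simp
  then show ?thesis unfolding primitive_recursive_iff by (rule exI)
qed

lemma pr_fst0: "primitive_recursive (\<lambda>x. p1 x)"
proof -
  have "primitive Fst \<and> (\<forall>A x. eval A Fst x = Some (p1 x))" by simp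
  then show ?thesis unfolding primitive_recursive_iff by (rule exI)
qed

lemma pr_snd0: "primitive_recursive (\<lambda>x. p2 x)"
proof -
  have "primitive Snd \<and> (\<forall>A x. eval A Snd x = Some (p2 x))" by simp
  then show ?thesis unfolding primitive_recursive_iff by (rule exI)
qed

lemmas pr_Suc = pr_comp[OF pr_Suc0]
lemmas pr_fst = pr_comp[OF pr_fst0]
lemmas pr_snd = pr_comp[OF pr_snd0]

lemma pr_zero: "primitive_recursive (\<lambda>x. 0)"
proof -
  have "primitive Zero \<and> (\<forall>A x. eval A Zero x = Some 0)" by simp
  then show ?thesis unfolding primitive_recursive_iff by (rule exI)
qed

lemma pr_const: "primitive_recursive (\<lambda>x. c)"
proof (induction c)
  case 0 show ?case by (rule pr_zero)
next
  case (Suc c) then show ?case by (rule pr_Suc)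
qed

text \<open>The recursion step in \<open>pr_rec\<close> sees its parameters only through
  projections. Several operations are therefore treated first at \<open>p1 t\<close> and
  \<open>p2 t\<close>, and arbitrary arguments are substituted afterwards.\<close>

lemma pr_comp2:
  assumes "primitive_recursive (\<lambda>t. F (p1 t) (p2 t))"
    and "primitive_recursive f" "primitive_recursive g"
  shows "primitive_recursive (\<lambda>x. F (f x) (g x))"
  using pr_comp[OF assms(1) pr_pair[OF assms(2,3)]] by simp

lemma pr_rec:
  assumes "primitive_recursive f" "primitive_recursive n"
    "primitive_recursive (\<lambda>t. g (p1 t) (p1 (p2 t)) (p2 (p2 t)))"
  shows "primitive_recursive (\<lambda>x. rec_nat (f x) (g x) (n x))"
proof -
  obtain p q where pq: "primitive p" "primitive q"
    "\<And>A x. eval A p x = Some (f x)" "\<And>A x. eval A q x = Some (g (p1 x) (p1 (p2 x)) (p2 (p2 x)))"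
    using assms(1,3) unfolding primitive_recursive_iff by blast
  have "rec_nat (eval A p a)
      (\<lambda>m r. do { v \<leftarrow> r; eval A q (prod_encode (a, prod_encode (m, v))) }) k
    = Some (rec_nat (f a) (g a) k)" for A a k
    by (induction k) (simp_all add: pq)
  then have "primitive (PrimRec p q)
    \<and> (\<forall>A x. eval A (PrimRec p q) x = Some (rec_nat (f (p1 x)) (g (p1 x)) (p2 x)))"
    using pq by (simp add: case_prod_beta)
  then have "primitive_recursive (\<lambda>t. rec_nat (f (p1 t)) (g (p1 t)) (p2 t))"
    unfolding primitive_recursive_iff by (rule exI)
  from pr_comp2[where F = "\<lambda>x y. rec_nat (f x) (g x) y", OF this pr_id assms(2)] show ?thesis .
qed

lemmas pr_basic = pr_id pr_const pr_Suc pr_fst pr_snd pr_pair pr_rec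

section \<open>Arithmetic, Boolean operations, bounded sums and quantifiers\<close>

lemma pr_add:
  assumes "primitive_recursive f" "primitive_recursive g"
  shows "primitive_recursive (\<lambda>x. f x + g x)"
proof -
  have "a + b = rec_nat a (\<lambda>m r. Suc r) b" for a b :: nat by (induction b) auto
  then show ?thesis by (simp only:) (intro pr_basic assms)
qed

lemma pr_mult:
  assumes "primitive_recursive f" "primitive_recursive g"
  shows "primitive_recursive (\<lambda>x. f x * g x)"
proof -
  have *: "a * b = rec_nat 0 (\<lambda>m r. r + a) b" for a b :: nat by (induction b) auto
  have "primitive_recursive (\<lambda>t. p1 t * p2 t)" unfolding * by (intro pr_basic pr_add)
  from pr_comp2[where F = "(*)", OF this assms] show ?thesis .
qed

lemma pr_power:
  assumes "primitive_recursive f" "primitive_recursive g"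
  shows "primitive_recursive (\<lambda>x. f x ^ g x)"
proof -
  have *: "a ^ b = rec_nat 1 (\<lambda>m r. r * a) b" for a b :: nat by (induction b) auto
  have "primitive_recursive (\<lambda>t. p1 t ^ p2 t)" unfolding * by (intro pr_basic pr_mult)
  from pr_comp2[where F = "(^)", OF this assms] show ?thesis .
qed

lemma pr_diff:
  assumes "primitive_recursive f" "primitive_recursive g"
  shows "primitive_recursive (\<lambda>x. f x - g x)"
proof -
  have pred: "n - Suc 0 = rec_nat 0 (\<lambda>m r. m) n" for n by (cases n) auto
  have "primitive_recursive (\<lambda>n. n - Suc 0)" unfolding pred by (intro pr_basic)
  note p = pr_comp[OF this]
  have *: "a - b = rec_nat a (\<lambda>m r. r - Suc 0) b" for a b :: nat by (induction b) auto
  have "primitive_recursive (\<lambda>t. p1 t - p2 t)" by (subst *) (intro pr_basic p)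
  from pr_comp2[where F = "(-)", OF this assms] show ?thesis .
qed

lemma pr_If:
  assumes "primitive_recursive (\<lambda>x. of_bool (P x))" "primitive_recursive f" "primitive_recursive g"
  shows "primitive_recursive (\<lambda>x. if P x then f x else g x)"
proof -
  have "(\<lambda>x. if P x then f x else g x) = (\<lambda>x. of_bool (P x) * f x + (1 - of_bool (P x)) * g x)"
    by auto
  then show ?thesis by (simp only:) (intro pr_const pr_add pr_mult pr_diff assms)
qed

lemma pr_not:
  assumes "primitive_recursive (\<lambda>x. of_bool (P x))"
  shows "primitive_recursive (\<lambda>x. of_bool (\<not> P x))"
proof -
  have "(\<lambda>x. of_bool (\<not> P x)) = (\<lambda>x. 1 - of_bool (P x) :: nat)" by auto
  then show ?thesis by (simp only:) (intro pr_const pr_diff assms)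
qed

lemma pr_conj:
  assumes "primitive_recursive (\<lambda>x. of_bool (P x))" "primitive_recursive (\<lambda>x. of_bool (Q x))"
  shows "primitive_recursive (\<lambda>x. of_bool (P x \<and> Q x))"
  unfolding of_bool_conj by (intro pr_mult assms)

lemma pr_disj:
  assumes "primitive_recursive (\<lambda>x. of_bool (P x))" "primitive_recursive (\<lambda>x. of_bool (Q x))"
  shows "primitive_recursive (\<lambda>x. of_bool (P x \<or> Q x))"
  using pr_not[OF pr_conj[OF pr_not[OF assms(1)] pr_not[OF assms(2)]]] by simp

lemma pr_imp:
  assumes "primitive_recursive (\<lambda>x. of_bool (P x))" "primitive_recursive (\<lambda>x. of_bool (Q x))"
  shows "primitive_recursive (\<lambda>x. of_bool (P x \<longrightarrow> Q x))"
  using pr_disj[OF pr_not[OF assms(1)] assms(2)] by simp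

lemma pr_le:
  assumes "primitive_recursive f" "primitive_recursive g"
  shows "primitive_recursive (\<lambda>x. of_bool (f x \<le> g x))"
proof -
  have "(\<lambda>x. of_bool (f x \<le> g x)) = (\<lambda>x. 1 - (f x - g x))" by auto
  then show ?thesis by (simp only:) (intro pr_const pr_diff assms)
qed

lemma pr_less:
  assumes "primitive_recursive f" "primitive_recursive g"
  shows "primitive_recursive (\<lambda>x. of_bool (f x < g x))"
  using pr_not[OF pr_le[OF assms(2,1)]] by (simp add: not_le)

lemma pr_eq:
  assumes "primitive_recursive f" "primitive_recursive g"
  shows "primitive_recursive (\<lambda>x. of_bool (f x = g x))"
  using pr_conj[OF pr_le[OF assms] pr_le[OF assms(2,1)]] by (simp flip: order_eq_iff)

lemma pr_sum:
  assumes "primitive_recursive n" "primitive_recursive (\<lambda>t. f (p1 t) (p2 t))"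
  shows "primitive_recursive (\<lambda>x. \<Sum>i<n x. f x i)"
proof -
  have *: "(\<Sum>i<k. f x i) = rec_nat 0 (\<lambda>m r. r + f x m) k" for x k by (induction k) auto
  show ?thesis unfolding *
    by (intro pr_basic pr_add assms(1) pr_comp2[where F=f, OF assms(2)])
qed

lemma pr_ball:
  assumes "primitive_recursive n" "primitive_recursive (\<lambda>t. of_bool (P (p1 t) (p2 t)))"
  shows "primitive_recursive (\<lambda>x. of_bool (\<forall>i<n x. P x i))"
proof -
  have *: "(of_bool (\<forall>i<n x. P x i)) = (of_bool ((\<Sum>i<n x. of_bool (\<not> P x i)) = (0::nat)) :: nat)" for x 
    by (auto simp: sum_eq_0_iff)
  show ?thesis unfolding * by (intro pr_const pr_eq pr_sum pr_not assms)
qed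

lemma pr_bex:
  assumes "primitive_recursive n" "primitive_recursive (\<lambda>t. of_bool (P (p1 t) (p2 t)))"
  shows "primitive_recursive (\<lambda>x. of_bool (\<exists>i<n x. P x i))"
proof -
  have "(\<lambda>x. of_bool (\<exists>i<n x. P x i) :: nat) = (\<lambda>x. of_bool (\<not> (\<forall>i<n x. \<not> P x i)))" by simp
  then show ?thesis by (simp only:) (intro pr_not pr_ball assms)
qed

text \<open>The quotient counts the positive multiples of the divisor up to the dividend; the
  conjunct \<open>0 < b\<close> yields 0 for division by 0.\<close>

lemma pr_div:
  assumes "primitive_recursive f" "primitive_recursive g"
  shows "primitive_recursive (\<lambda>x. f x div g x)"
proof -
  have *: "a div b = (\<Sum>i<a. of_bool (0 < b \<and> Suc i * b \<le> a))" for a b :: nat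
  proof (cases "b = 0")
    case False
    have "i < a \<and> 0 < b \<and> Suc i * b \<le> a \<longleftrightarrow> i < a div b" for i
    proof -
      have "i < a div b \<longleftrightarrow> Suc i * b \<le> a"
        using False by (simp add: Suc_le_eq[symmetric] less_eq_div_iff_mult_less_eq)
      moreover have "i < a div b \<Longrightarrow> i < a" using div_le_dividend[of a b] by linarith
      ultimately show ?thesis using False by auto
    qed
    then have "{..<a} \<inter> {i. 0 < b \<and> Suc i * b \<le> a} = {..<a div b}" by auto
    then show ?thesis by (simp add: sum.If_cases of_bool_def)
  qed simp
  have "primitive_recursive (\<lambda>t. p1 t div p2 t)"
    by (subst *) (intro pr_basic pr_sum pr_conj pr_less pr_le pr_mult)
  from pr_comp2[where F = "(div)", OF this assms] show ?thesis .
qed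

lemma pr_even:
  assumes "primitive_recursive f"
  shows "primitive_recursive (\<lambda>x. of_bool (even (f x)))"
proof -
  have "(\<lambda>x. of_bool (even (f x)) :: nat) = (\<lambda>x. of_bool (f x = 2 * (f x div 2)))"
    by (intro ext arg_cong[where f = of_bool]) presburger
  then show ?thesis by (simp only:) (intro pr_eq pr_mult pr_div pr_const assms)
qed

text \<open>Bounded minimization with the bound as default: a failed search returns
  \<open>B\<close>.\<close>

definition bleast :: "(nat \<Rightarrow> bool) \<Rightarrow> nat \<Rightarrow> nat" where
  "bleast P B = (LEAST n. P n \<or> B \<le> n)"

lemma bleast_le: "bleast P B \<le> B"
  unfolding bleast_def by (rule Least_le) simp

lemma bleast_cases: "P (bleast P B) \<or> bleast P B = B"
  using LeastI[of "\<lambda>n. P n \<or> B \<le> n" B] bleast_le[of P B] unfolding bleast_def by auto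

lemma not_less_bleast: "i < bleast P B \<Longrightarrow> \<not> P i"
  unfolding bleast_def using not_less_Least by blast

lemma bleast_eqI:
  assumes "\<And>i. i < n \<Longrightarrow> \<not> P i" "n \<le> B" "P n \<or> n = B"
  shows "bleast P B = n"
  unfolding bleast_def
proof (rule Least_equality)
  show "P n \<or> B \<le> n" using assms by auto
  show "n \<le> y" if "P y \<or> B \<le> y" for y
    using that assms by (meson le_trans not_le)
qed

text \<open>The value is the number of \<open>i\<close> below the bound such that no
  \<open>j \<le> i\<close> is a solution; this count also produces the default.\<close>

lemma pr_bleast:
  assumes "primitive_recursive n" "primitive_recursive (\<lambda>t. of_bool (P (p1 t) (p2 t)))"
  shows "primitive_recursive (\<lambda>x. bleast (P x) (n x))"
proof -
  have *: "bleast Q B = (\<Sum>i<B. of_bool (\<forall>j<Suc i. \<not> Q j))" for Q B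
  proof -
    have "(\<forall>j<Suc i. \<not> Q j) \<longleftrightarrow> i < bleast Q B" if "i < B" for i
    proof
      assume "\<forall>j<Suc i. \<not> Q j"
      then show "i < bleast Q B"
        using bleast_cases[of Q B] that by (metis less_Suc_eq_le linorder_not_less)
    next
      assume "i < bleast Q B"
      then show "\<forall>j<Suc i. \<not> Q j" 
        using not_less_bleast[of _ Q B] by (metis less_Suc_eq_le order_le_less_trans)
    qed
    then have "{..<B} \<inter> {i. \<forall>j<Suc i. \<not> Q j} = {..<bleast Q B}"
      using bleast_le[of Q B] order_less_le_trans[of _ "bleast Q B" B] by blast
    then show ?thesis by (simp add: sum.If_cases of_bool_def)
  qed
  show ?thesis unfolding *
    by (intro pr_basic pr_sum pr_ball pr_not assms(1)
        pr_comp2[where F = "\<lambda>x i. of_bool (P x i)", OF assms(2)])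
qed

lemmas pr_intros = pr_basic pr_add pr_mult pr_power pr_diff pr_div pr_If
  pr_not pr_conj pr_disj pr_imp pr_le pr_less pr_eq pr_even pr_sum pr_ball pr_bex pr_bleast

section \<open>Strings\<close>

definition str_of :: "nat \<Rightarrow> bool list" where
  "str_of = inv str_code"

lemma str_of_str_code [simp]: "str_of (str_code \<sigma>) = \<sigma>"
  and str_code_str_of [simp]: "str_code (str_of c) = c"
  using bij_str_code by (simp_all add: str_of_def bij_is_inj bij_is_surj surj_f_inv_f)

lemma str_code_inj [simp]: "str_code \<sigma> = str_code \<tau> \<longleftrightarrow> \<sigma> = \<tau>"
  by (metis str_of_str_code)

text \<open>Codes are binary numerals with the digits 1 and 2, so deleting the last bit halves the
  predecessor. The empty string, with code 0, stays fixed.\<close>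

lemma str_code_butlast: "(str_code \<sigma> - Suc 0) div 2 = str_code (butlast \<sigma>)"
proof (cases \<sigma> rule: rev_cases)
  case (snoc \<tau> b)
  have "(2 * n + (if b then 2 else 1) - Suc 0) div 2 = n" for n by (cases b) simp_all
  then show ?thesis using snoc by (simp only: str_code_snoc butlast_snoc)
qed simp

lemma even_str_code: "\<sigma> \<noteq> [] \<Longrightarrow> even (str_code \<sigma>) \<longleftrightarrow> last \<sigma>"
  by (cases \<sigma> rule: rev_cases) auto

lemma length_le_str_code: "length \<sigma> \<le> str_code \<sigma>"
  by (induction \<sigma> rule: rev_induct) auto

lemma str_code_less: "str_code \<sigma> + 2 \<le> 2 ^ Suc (length \<sigma>)"
  by (induction \<sigma> rule: rev_induct) auto

text \<open>Bits are deleted from the end, where codes are accessible to arithmetic; lengths, bits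
  and prefixes are all read off from this operation.\<close>

definition drop_bits :: "nat \<Rightarrow> nat \<Rightarrow> nat" where
  "drop_bits c k = rec_nat c (\<lambda>_ r. (r - Suc 0) div 2) k"

lemma drop_bits: "drop_bits c k = str_code (take (length (str_of c) - k) (str_of c))"
proof (induction k)
  case 0 show ?case by (simp add: drop_bits_def)
next
  case (Suc k)
  have "drop_bits c (Suc k) = (drop_bits c k - Suc 0) div 2" by (simp add: drop_bits_def)
  then show ?case by (simp add: Suc str_code_butlast butlast_take)
qed

lemma pr_drop_bits:
  assumes "primitive_recursive f" "primitive_recursive g"
  shows "primitive_recursive (\<lambda>x. drop_bits (f x) (g x))"
  unfolding drop_bits_def by (intro pr_intros assms)

lemma pr_length:
  assumes "primitive_recursive f"
  shows "primitive_recursive (\<lambda>x. length (str_of (f x)))"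
proof -
  have *: "length (str_of c) = bleast (\<lambda>k. drop_bits c k = 0) c" for c
  proof (rule bleast_eqI[symmetric])
    fix i assume "i < length (str_of c)"
    then have "take (length (str_of c) - i) (str_of c) \<noteq> []" by auto
    then show "drop_bits c i \<noteq> 0" unfolding drop_bits by (metis str_code_Nil str_code_inj)
  qed (use length_le_str_code[of "str_of c"] in \<open>auto simp: drop_bits\<close>)
  have "primitive_recursive (\<lambda>c. length (str_of c))"
    unfolding * by (intro pr_intros pr_drop_bits)
  from pr_comp[OF this assms] show ?thesis .
qed

text \<open>A bit becomes the last one, and thus a parity, once the bits after it are deleted. The
  range condition fixes the value outside the string.\<close>

lemma pr_nth:
  assumes "primitive_recursive f" "primitive_recursive g"
  shows "primitive_recursive (\<lambda>x. of_bool (g x < length (str_of (f x)) \<and> str_of (f x) ! g x))"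
proof -
  have *: "i < length (str_of c) \<and> str_of c ! i \<longleftrightarrow>
      i < length (str_of c) \<and> even (drop_bits c (length (str_of c) - Suc i))" for c i
  proof (cases "i < length (str_of c)")
    case True
    then have "last (take (Suc i) (str_of c)) = str_of c ! i"
      by (simp add: take_Suc_conv_app_nth)
    moreover have "take (Suc i) (str_of c) \<noteq> []" using True by auto
    moreover have "length (str_of c) - (length (str_of c) - Suc i) = Suc i" using True by simp
    ultimately show ?thesis using even_str_code[of "take (Suc i) (str_of c)"] by (simp add: drop_bits)
  qed simp
  show ?thesis unfolding * by (intro pr_intros pr_length pr_drop_bits assms)
qed

lemma pr_prefix:
  assumes "primitive_recursive f" "primitive_recursive g"
  shows "primitive_recursive (\<lambda>x. of_bool (prefix (str_of (f x)) (str_of (g x))))"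
proof -
  have *: "prefix (str_of c) (str_of d) \<longleftrightarrow> (\<exists>k<Suc d. drop_bits d k = c)" for c d
  proof
    assume p: "prefix (str_of c) (str_of d)"
    define k where "k = length (str_of d) - length (str_of c)"
    have "k < Suc d" using length_le_str_code[of "str_of d"] by (simp add: k_def)
    moreover have "length (str_of d) - k = length (str_of c)"
      using prefix_length_le[OF p] by (simp add: k_def)
    then have "drop_bits d k = c"
      unfolding drop_bits by (metis p append_eq_conv_conj prefix_def str_code_str_of)
    ultimately show "\<exists>k<Suc d. drop_bits d k = c" by blast
  qed (auto simp: drop_bits take_is_prefix)
  have "primitive_recursive (\<lambda>t. of_bool (prefix (str_of (p1 t)) (str_of (p2 t))))"
    unfolding * by (intro pr_intros pr_drop_bits)
  from pr_comp2[where F = "\<lambda>c d. of_bool (prefix (str_of c) (str_of d))", OF this assms]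
  show ?thesis .
qed

lemma length_restr [simp]: "length (X \<restriction> n) = n"
  by (simp add: restr_def)

lemma nth_restr [simp]: "i < n \<Longrightarrow> (X \<restriction> n) ! i = X i"
  by (simp add: restr_def)

lemma prefix_restr: "m \<le> n \<Longrightarrow> prefix (X \<restriction> m) (X \<restriction> n)"
  unfolding restr_def by (metis le_Suc_ex map_append prefixI upt_add_eq_append zero_le)

lemma in_cylinder_restr: "X \<in> cylinder (X \<restriction> n)"
  by (simp add: cylinder_def)

text \<open>A number is unpaired repeatedly into an infinite sequence. No length is stored: in a
  fan, \<open>n\<close> determines how many entries matter.\<close>

definition component :: "nat \<Rightarrow> nat \<Rightarrow> nat" where
  "component w j = p1 (rec_nat w (\<lambda>_ r. p2 r) j)"

lemma component_surj: "\<exists>w. \<forall>j<length xs. component w j = xs ! j"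
proof (induction xs)
  case (Cons x xs)
  then obtain w where w: "\<forall>j<length xs. component w j = xs ! j" by blast
  have "rec_nat (prod_encode (x, w)) (\<lambda>_ r. p2 r) (Suc j) = rec_nat w (\<lambda>_ r. p2 r) j" for j
    by (induction j) auto
  then have "component (prod_encode (x, w)) (Suc j) = component w j" for j
    unfolding component_def by metis
  moreover have "component (prod_encode (x, w)) 0 = x" by (simp add: component_def)
  ultimately have "\<forall>j<length (x # xs). component (prod_encode (x, w)) j = (x # xs) ! j"
    using w by (auto simp: nth_Cons split: nat.split)
  then show ?case by blast
qed simp

lemma pr_component:
  assumes "primitive_recursive f" "primitive_recursive g"
  shows "primitive_recursive (\<lambda>x. component (f x) (g x))"
  unfolding component_def by (intro pr_intros assms)

section \<open>Bounded evaluation with string oracles\<close>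

text \<open>
  The value \<open>0\<close> stands for divergence and \<open>v + 1\<close> for the result \<open>v\<close>. The length of the string bounds
  both the oracle queries and the \<open>\<mu>\<close>-searches, so that \<open>run p\<close> is primitive recursive for each \<open>p\<close>.
\<close>

primrec run :: "prog \<Rightarrow> bool list \<Rightarrow> nat \<Rightarrow> nat" where
  "run Zero \<tau> = (\<lambda>x. 1)"
| "run Succ \<tau> = (\<lambda>x. Suc (Suc x))"
| "run Fst \<tau> = (\<lambda>x. Suc (p1 x))"
| "run Snd \<tau> = (\<lambda>x. Suc (p2 x))"
| "run Query \<tau> = (\<lambda>x. if x < length \<tau> then Suc (of_bool (x < length \<tau> \<and> \<tau> ! x)) else 0)"
| "run (Tuple p q) \<tau> = (\<lambda>x. if run p \<tau> x = 0 \<or> run q \<tau> x = 0 then 0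
     else Suc (prod_encode (run p \<tau> x - 1, run q \<tau> x - 1)))"
| "run (Compose p q) \<tau> = (\<lambda>x. if run q \<tau> x = 0 then 0 else run p \<tau> (run q \<tau> x - 1))"
| "run (PrimRec p q) \<tau> = (\<lambda>x. rec_nat (run p \<tau> (p1 x))
     (\<lambda>m r. if r = 0 then 0 else run q \<tau> (prod_encode (p1 x, prod_encode (m, r - 1)))) (p2 x))"
| "run (Mu p) \<tau> = (\<lambda>x.
     if bleast (\<lambda>n. run p \<tau> (prod_encode (x, n)) \<le> 1) (length \<tau>) < length \<tau>
       \<and> run p \<tau> (prod_encode (x, bleast (\<lambda>n. run p \<tau> (prod_encode (x, n)) \<le> 1) (length \<tau>))) = 1
     then Suc (bleast (\<lambda>n. run p \<tau> (prod_encode (x, n)) \<le> 1) (length \<tau>)) else 0)"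

text \<open>The search inside \<open>run\<close> stops at the first argument where \<open>p\<close>
  diverges, coded 0, or returns 0, coded 1. It succeeds only in the second case, so every earlier
  code exceeds 1.\<close>

lemma run_MuI:
  assumes "n < length \<tau>" "run p \<tau> (prod_encode (x, n)) = 1"
    "\<And>m. m < n \<Longrightarrow> 1 < run p \<tau> (prod_encode (x, m))"
  shows "run (Mu p) \<tau> x = Suc n"
proof -
  have "bleast (\<lambda>n. run p \<tau> (prod_encode (x, n)) \<le> 1) (length \<tau>) = n"
    using assms by (intro bleast_eqI) (auto simp: not_le)
  then show ?thesis using assms by simp
qed

lemma run_MuE:
  assumes "run (Mu p) \<tau> x \<noteq> 0"
  obtains n where "n < length \<tau>" "run p \<tau> (prod_encode (x, n)) = 1"
    "\<And>m. m < n \<Longrightarrow> 1 < run p \<tau> (prod_encode (x, m))"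
proof
  let ?n = "bleast (\<lambda>n. run p \<tau> (prod_encode (x, n)) \<le> 1) (length \<tau>)"
  show "?n < length \<tau>" "run p \<tau> (prod_encode (x, ?n)) = 1"
    using assms by (auto split: if_splits)
  show "1 < run p \<tau> (prod_encode (x, m))" if "m < ?n" for m
    using not_less_bleast[OF that] by simp
qed

text \<open>The use principle: a convergent run reads only bits of \<open>\<sigma>\<close> and
  searches only below its length, so an extension changes nothing.\<close>

lemma run_mono:
  assumes "prefix \<sigma> \<tau>" "run p \<sigma> x \<noteq> 0"
  shows "run p \<tau> x = run p \<sigma> x"
  using assms(2)
proof (induction p arbitrary: x)
  case Query
  with assms(1) show ?case by (auto simp: prefix_def nth_append split: if_splits)
next
  case (PrimRec p q)
  define R where "R \<rho> = rec_nat (run p \<rho> (p1 x))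
     (\<lambda>m r. if r = 0 then 0 else run q \<rho> (prod_encode (p1 x, prod_encode (m, r - 1))))" for \<rho>
  have "R \<sigma> n \<noteq> 0 \<Longrightarrow> R \<tau> n = R \<sigma> n" for n
    by (induction n) (auto simp: R_def PrimRec.IH split: if_splits)
  then show ?case using PrimRec.prems by (simp add: R_def)
next
  case (Mu p)
  obtain n where n: "n < length \<sigma>" "run p \<sigma> (prod_encode (x, n)) = 1"
    "\<And>m. m < n \<Longrightarrow> 1 < run p \<sigma> (prod_encode (x, m))"
    using run_MuE[OF Mu.prems] by blast
  have eq: "run p \<tau> (prod_encode (x, m)) = run p \<sigma> (prod_encode (x, m))" if "m \<le> n" for m
    using n(2) n(3)[of m] that by (intro Mu.IH) (cases "m = n", auto)
  have "run (Mu p) \<sigma> x = Suc n" using n by (intro run_MuI)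
  moreover have "run (Mu p) \<tau> x = Suc n"
    using n eq prefix_length_le[OF assms(1)] by (intro run_MuI) auto
  ultimately show ?case by simp
qed (auto split: if_splits)

lemma run_restr_mono:
  "run p (Y \<restriction> L) x \<noteq> 0 \<Longrightarrow> L \<le> L' \<Longrightarrow> run p (Y \<restriction> L') x = run p (Y \<restriction> L) x"
  using run_mono prefix_restr by blast

text \<open>The maximum of finitely many thresholds is a common threshold; this is how finitely many
  computations are awaited at once.\<close>

lemma uniform_bound:
  assumes "\<And>i. i < (n::nat) \<Longrightarrow> \<exists>L. \<forall>l\<ge>L. P i l" 
  shows "\<exists>L::nat. \<forall>l\<ge>L. \<forall>i<n. P i l"
  using assms
proof (induction n)
  case (Suc n)
  obtain L1 where L1: "\<forall>l\<ge>L1. \<forall>i<n. P i l" using Suc by (metis less_SucI)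
  obtain L2 where L2: "\<forall>l\<ge>L2. P n l" using Suc.prems by blast
  show ?case using L1 L2 by (intro exI[of _ "max L1 L2"]) (auto simp: less_Suc_eq)
qed simp

text \<open>A convergent computation asks finitely many questions and performs finitely many finite
  searches, so a long enough initial segment of the oracle suffices.\<close>

lemma run_converges:
  assumes "eval (oracle_of Y) p x = Some v"
  shows "\<exists>L. \<forall>l\<ge>L. run p (Y \<restriction> l) x = Suc v"
  using assms
proof (induction p arbitrary: x v)
  case Query
  then have "\<forall>l\<ge>Suc x. run Query (Y \<restriction> l) x = Suc v" by (auto simp: oracle_of_def)
  then show ?case by blast
next
  case (Tuple p q)
  then obtain a b where ab: "eval (oracle_of Y) p x = Some a" "eval (oracle_of Y) q x = Some b"
    "v = prod_encode (a, b)" by (auto split: bind_splits)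
  obtain L1 L2 where "\<forall>l\<ge>L1. run p (Y \<restriction> l) x = Suc a" "\<forall>l\<ge>L2. run q (Y \<restriction> l) x = Suc b"
    using Tuple.IH ab by blast
  then show ?case using ab(3) by (intro exI[of _ "max L1 L2"]) auto
next
  case (Compose p q)
  then obtain a where a: "eval (oracle_of Y) q x = Some a" "eval (oracle_of Y) p a = Some v"
    by (auto split: bind_splits)
  obtain L1 L2 where "\<forall>l\<ge>L1. run q (Y \<restriction> l) x = Suc a" "\<forall>l\<ge>L2. run p (Y \<restriction> l) a = Suc v"
    using Compose.IH a by blast
  then show ?case by (intro exI[of _ "max L1 L2"]) auto
next
  case (PrimRec p q)
  obtain a n where x: "x = prod_encode (a, n)" by (metis prod_decode_inverse surj_pair)
  define E where "E = rec_nat (eval (oracle_of Y) p a)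
    (\<lambda>m r. do { v \<leftarrow> r; eval (oracle_of Y) q (prod_encode (a, prod_encode (m, v))) })"
  define R where "R \<rho> = rec_nat (run p \<rho> a)
     (\<lambda>m r. if r = 0 then 0 else run q \<rho> (prod_encode (a, prod_encode (m, r - 1))))" for \<rho>
  have "\<exists>L. \<forall>l\<ge>L. R (Y \<restriction> l) n = Suc v" if "E n = Some v" for n v
    using that
  proof (induction n arbitrary: v)
    case 0
    then show ?case using PrimRec.IH(1) by (simp add: E_def R_def)
  next
    case (Suc n)
    then obtain u where u: "E n = Some u"
      "eval (oracle_of Y) q (prod_encode (a, prod_encode (n, u))) = Some v"
      by (auto simp: E_def split: bind_splits)
    obtain L1 where "\<forall>l\<ge>L1. R (Y \<restriction> l) n = Suc u" using Suc.IH u(1) by blast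
    moreover obtain L2 where
      "\<forall>l\<ge>L2. run q (Y \<restriction> l) (prod_encode (a, prod_encode (n, u))) = Suc v"
      using PrimRec.IH(2) u(2) by blast
    ultimately show ?case by (intro exI[of _ "max L1 L2"]) (auto simp: R_def)
  qed
  then show ?case using PrimRec.prems by (simp add: x E_def R_def cong: if_cong)
next
  case (Mu p)
  let ?E = "\<lambda>n. eval (oracle_of Y) p (prod_encode (x, n))"
  have ex: "\<exists>n. ?E n = Some 0 \<and> (\<forall>m<n. ?E m \<noteq> None)" and v: "v = (LEAST n. ?E n = Some 0)"
    using Mu.prems by (auto split: if_splits)
  obtain n0 where n0: "?E n0 = Some 0" "\<forall>m<n0. ?E m \<noteq> None" using ex by blast
  have v0: "?E v = Some 0" unfolding v by (rule LeastI[of "\<lambda>n. ?E n = Some 0" n0, OF n0(1)])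
  have "v \<le> n0" unfolding v by (rule Least_le[of "\<lambda>n. ?E n = Some 0" n0, OF n0(1)])
  have lt: "\<exists>a. ?E m = Some (Suc a)" if "m < v" for m
  proof -
    have "?E m \<noteq> Some 0" using not_less_Least[of m "\<lambda>n. ?E n = Some 0"] that v by blast
    moreover have "?E m \<noteq> None" using n0(2) that \<open>v \<le> n0\<close> by auto
    ultimately show ?thesis by (metis not0_implies_Suc option.exhaust)
  qed
  obtain L0 where L0: "\<forall>l\<ge>L0. run p (Y \<restriction> l) (prod_encode (x, v)) = Suc 0"
    using Mu.IH[OF v0] by blast
  have ev: "\<exists>L. \<forall>l\<ge>L. 1 < run p (Y \<restriction> l) (prod_encode (x, m))" if m: "m < v" for m
  proof -
    obtain a where "?E m = Some (Suc a)" using lt[OF m] by blast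
    from Mu.IH[OF this] obtain L
      where "\<forall>l\<ge>L. run p (Y \<restriction> l) (prod_encode (x, m)) = Suc (Suc a)" by blast
    then show ?thesis by (intro exI[of _ L]) simp
  qed
  have "\<exists>L. \<forall>l\<ge>L. \<forall>m<v. 1 < run p (Y \<restriction> l) (prod_encode (x, m))"
    by (rule uniform_bound) (rule ev)
  then obtain L1 where L1: "\<forall>l\<ge>L1. \<forall>m<v. 1 < run p (Y \<restriction> l) (prod_encode (x, m))" by blast
  have "run (Mu p) (Y \<restriction> l) x = Suc v" if "l \<ge> max (Suc v) (max L0 L1)" for l
    using L0 L1 that by (intro run_MuI) auto
  then show ?case by blast
qed (auto simp: exI[of _ 0])

text \<open>A longer initial segment gives the true value by \<open>run_converges\<close>, and by
  monotonicity the convergent run already had it.\<close>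

lemma run_value:
  assumes "eval (oracle_of Y) p x = Some v" "run p (Y \<restriction> l) x \<noteq> 0"
  shows "run p (Y \<restriction> l) x = Suc v"
proof -
  obtain L where "\<forall>l\<ge>L. run p (Y \<restriction> l) x = Suc v" using run_converges[OF assms(1)] by blast
  then have "run p (Y \<restriction> max L l) x = Suc v" by simp
  then show ?thesis using run_restr_mono[OF assms(2), of "max L l"] by simp
qed

lemma pr_run:
  assumes "primitive_recursive f" "primitive_recursive g"
  shows "primitive_recursive (\<lambda>x. run p (str_of (f x)) (g x))"
  using assms
proof (induction p arbitrary: f g)
  case Zero
  then show ?case by (simp only: run.simps) (intro pr_intros)
next
  case Succ
  then show ?case by (simp only: run.simps) (intro pr_intros)
next
  case Fst
  then show ?case by (simp only: run.simps) (intro pr_intros)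
next
  case Snd
  then show ?case by (simp only: run.simps) (intro pr_intros)
next
  case Query
  then show ?case by (simp only: run.simps) (intro pr_intros pr_length pr_nth)
next
  case (Tuple p q)
  then show ?case by (simp only: run.simps) (intro pr_intros Tuple)
next
  case (Compose p q)
  then show ?case by (simp only: run.simps) (intro pr_intros Compose)
next
  case (PrimRec p q)
  have "primitive_recursive (\<lambda>t. run (PrimRec p q) (str_of (p1 t)) (p2 t))"
    by (simp only: run.simps) (intro pr_intros PrimRec.IH)
  from pr_comp2[where F = "\<lambda>c x. run (PrimRec p q) (str_of c) x", OF this PrimRec.prems]
  show ?case .
next
  case (Mu p)
  have "primitive_recursive (\<lambda>t. run (Mu p) (str_of (p1 t)) (p2 t))"
    by (simp only: run.simps) (intro pr_intros pr_length Mu.IH)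
  from pr_comp2[where F = "\<lambda>c x. run (Mu p) (str_of c) x", OF this Mu.prems]
  show ?case .
qed

section \<open>Indices\<close>

lemma primitive_recursive_computable: "primitive_recursive f \<Longrightarrow> computable f"
  unfolding primitive_recursive_def computable_def by blast

lemma primitive_recursive_computable2:
  assumes "primitive_recursive (\<lambda>t. f (p1 t) (p2 t))"
  shows "computable2 f"
proof -
  obtain p where "\<And>A x. eval A p x = Some (f (p1 x) (p2 x))"
    using primitive_recursive_progE[OF assms] by blast
  then have "eval empty_oracle p (prod_encode (x, y)) = Some (f x y)" for x y by simp
  then show ?thesis unfolding computable2_def by blast
qed

lemma eval_Mu_total:
  assumes "\<And>n. eval A p (prod_encode (x, n)) = Some (of_bool (\<not> P n))"
  shows "eval A (Mu p) x = (if \<exists>n. P n then Some (LEAST n. P n) else None)"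
proof -
  have "eval A p (prod_encode (x, n)) = Some 0 \<longleftrightarrow> P n" for n using assms[of n] by simp
  then show ?thesis using assms by simp
qed

text \<open>The source of all indices below: both the open sets and the questions to
  \<open>zero_jump\<close> are given by searches for a witness of a primitive recursive
  relation.\<close>

lemma search_prog:
  assumes "primitive_recursive (\<lambda>t. of_bool (R (p1 t) (p2 t)))"
  shows "\<exists>p. \<forall>A x. eval A p x = (if \<exists>n. R x n then Some (LEAST n. R x n) else None)"
proof -
  obtain p where p: "\<And>A x. eval A p x = Some (of_bool (\<not> R (p1 x) (p2 x)))"
    using primitive_recursive_progE[OF pr_not[OF assms]] by blast
  have "\<forall>A x. eval A (Mu p) x = (if \<exists>n. R x n then Some (LEAST n. R x n) else None)"
    by (intro allI eval_Mu_total) (simp add: p)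
  then show ?thesis by blast
qed

primrec const_prog :: "nat \<Rightarrow> prog" where
  "const_prog 0 = Zero"
| "const_prog (Suc n) = Compose Succ (const_prog n)"

lemma eval_const_prog [simp]: "eval A (const_prog n) x = Some n"
  by (induction n) auto

definition smn :: "prog \<Rightarrow> nat \<Rightarrow> nat" where
  "smn p y = prog_code (Compose p (Tuple (const_prog y) (Tuple Fst Snd)))"

lemma eval_smn [simp]: "eval A (prog_of (smn p y)) x = eval A p (prod_encode (y, x))"
  unfolding smn_def prog_of_prog_code by simp

lemma pr_smn:
  assumes "primitive_recursive f"
  shows "primitive_recursive (\<lambda>x. smn p (f x))"
proof -
  \<comment> \<open>By the coding of programs, composing \<open>Succ\<close>, whose code is 1, with
    a program of code \<open>r\<close> gives the code
    \<open>6 + 4 * prod_encode (1, r)\<close>.\<close>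
  have c: "prog_code (const_prog n) = rec_nat 0 (\<lambda>_ r. 6 + 4 * prod_encode (1, r)) n" for n
    by (induction n) auto
  show ?thesis unfolding smn_def prog_code.simps c by (intro pr_intros assms)
qed

text \<open>The parameter \<open>y\<close> is hardwired into a search program whose remaining input
  is the code of a string, so an index is obtained uniformly in \<open>y\<close>.\<close>

lemma eff_open_index:
  assumes "primitive_recursive (\<lambda>t. of_bool (R (p1 t) (p1 (p2 t)) (p2 (p2 t))))"
  obtains g where "primitive_recursive g"
    "\<And>y. \<W> (g y) = (\<Union>\<sigma>\<in>{\<sigma>. \<exists>n. R y (str_code \<sigma>) n}. cylinder \<sigma>)"
proof -
  have "primitive_recursive (\<lambda>t. of_bool (R (p1 (p1 t)) (p2 (p1 t)) (p2 t)))"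
    using pr_comp[OF assms pr_pair[OF pr_fst[OF pr_fst0] pr_pair[OF pr_snd[OF pr_fst0] pr_snd0]]]
    by simp
  then obtain p where "\<And>A x. eval A p x = (if \<exists>n. R (p1 x) (p2 x) n
      then Some (LEAST n. R (p1 x) (p2 x) n) else None)"
    using search_prog[where R = "\<lambda>x. R (p1 x) (p2 x)"] by blast
  then have "\<W> (smn p y) = (\<Union>\<sigma>\<in>{\<sigma>. \<exists>n. R y (str_code \<sigma>) n}. cylinder \<sigma>)" for y
    by (simp add: eff_open_def)
  with pr_smn[OF pr_id] show ?thesis by (rule that)
qed

text \<open>The search ignores its input and looks only at the hardwired \<open>y\<close>, so
  halting on its own index means that a witness exists.\<close>

lemma zero_jump_index:
  assumes "primitive_recursive (\<lambda>t. of_bool (R (p1 t) (p2 t)))"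
  obtains g where "primitive_recursive g" "\<And>y. zero_jump (g y) \<longleftrightarrow> (\<exists>n. R y n)"
proof -
  have "primitive_recursive (\<lambda>t. of_bool (R (p1 (p1 t)) (p2 t)))"
    using pr_comp[OF assms pr_pair[OF pr_fst[OF pr_fst0] pr_snd0]] by simp
  then obtain p where "\<And>A x. eval A p x = (if \<exists>n. R (p1 x) n
      then Some (LEAST n. R (p1 x) n) else None)"
    using search_prog[where R = "\<lambda>x. R (p1 x)"] by blast
  then have "zero_jump (smn p y) \<longleftrightarrow> (\<exists>n. R y n)" for y
    by (simp add: zero_jump_def)
  with pr_smn[OF pr_id] show ?thesis by (rule that)
qed

section \<open>Measure of open sets\<close>

lemma prob_space_cantor_measure: "prob_space cantor_measure"
  unfolding cantor_measure_def by (intro prob_space_PiM prob_space_measure_pmf)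

lemma cylinder_disjoint:
  assumes "length \<sigma> = length \<tau>" "\<sigma> \<noteq> \<tau>"
  shows "cylinder \<sigma> \<inter> cylinder \<tau> = {}"
  using assms by (auto simp: cylinder_def)

lemma measure_strings:
  assumes "finite S" "\<And>\<sigma>. \<sigma> \<in> S \<Longrightarrow> length \<sigma> = L"
  shows "measure cantor_measure (\<Union>\<sigma>\<in>S. cylinder \<sigma>) = card S / 2 ^ L"
proof -
  interpret prob_space cantor_measure by (rule prob_space_cantor_measure)
  have "disjoint_family_on cylinder S"
    unfolding disjoint_family_on_def using assms(2) by (simp add: cylinder_disjoint)
  then have "measure cantor_measure (\<Union>\<sigma>\<in>S. cylinder \<sigma>) = (\<Sum>\<sigma>\<in>S. measure cantor_measure (cylinder \<sigma>))"
    using assms(1) by (intro finite_measure_finite_Union) (auto simp: sets_cylinder)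
  also have "\<dots> = (\<Sum>\<sigma>\<in>S. (1 / 2) ^ L)"
    using assms(2) by (intro sum.cong) (auto simp: measure_cylinder)
  also have "\<dots> = card S / 2 ^ L" by (simp add: power_one_over)
  finally show ?thesis .
qed

lemma sets_cylinder_union: "(\<Union>\<sigma>\<in>A. cylinder \<sigma>) \<in> sets cantor_measure"
  by (rule sets.countable_UN'') (auto simp: sets_cylinder)

lemma finite_strings: "finite {\<sigma> :: bool list. length \<sigma> = L \<and> P \<sigma>}"
  using finite_lists_length_eq[of "UNIV :: bool set" L]
  by (rule rev_finite_subset[OF _ Collect_mono]) simp_all

lemma measure_open_ge:
  "card {\<sigma>. length \<sigma> = L \<and> P \<sigma>} / 2 ^ L \<le> measure cantor_measure (\<Union>\<sigma>\<in>Collect P. cylinder \<sigma>)"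
proof -
  interpret prob_space cantor_measure by (rule prob_space_cantor_measure)
  have "measure cantor_measure (\<Union>\<sigma>\<in>{\<sigma>. length \<sigma> = L \<and> P \<sigma>}. cylinder \<sigma>)
      = card {\<sigma>. length \<sigma> = L \<and> P \<sigma>} / 2 ^ L"
    by (intro measure_strings finite_strings) auto
  moreover have "measure cantor_measure (\<Union>\<sigma>\<in>{\<sigma>. length \<sigma> = L \<and> P \<sigma>}. cylinder \<sigma>)
      \<le> measure cantor_measure (\<Union>\<sigma>\<in>Collect P. cylinder \<sigma>)"
    by (intro finite_measure_mono sets_cylinder_union) auto
  ultimately show ?thesis by simp
qed

text \<open>Since \<open>P\<close> is closed under extension, the level sets increase to the open
  set, and continuity from below carries the bound to the limit. Together with
  \<open>measure_open_ge\<close>, exceeding a given measure is witnessed by a single level.\<close>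

lemma measure_open_le:
  assumes mono: "\<And>\<sigma> \<tau>. P \<sigma> \<Longrightarrow> prefix \<sigma> \<tau> \<Longrightarrow> P \<tau>"
    and card: "\<And>L. card {\<sigma>. length \<sigma> = L \<and> P \<sigma>} / 2 ^ L \<le> r"
  shows "measure cantor_measure (\<Union>\<sigma>\<in>Collect P. cylinder \<sigma>) \<le> r"
proof -
  interpret prob_space cantor_measure by (rule prob_space_cantor_measure)
  define U where "U L = (\<Union>\<sigma>\<in>{\<sigma>. length \<sigma> = L \<and> P \<sigma>}. cylinder \<sigma>)" for L
  have U_iff: "Y \<in> U L \<longleftrightarrow> P (Y \<restriction> L)" for Y L
    by (auto simp: U_def cylinder_def)
  have "incseq U"
    unfolding incseq_def using U_iff mono prefix_restr by blast
  have "(\<Union>\<sigma>\<in>Collect P. cylinder \<sigma>) = (\<Union>L. U L)"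
    by (auto simp: U_def)
  moreover have "(\<lambda>L. measure cantor_measure (U L)) \<longlonglongrightarrow> measure cantor_measure (\<Union>L. U L)"
    by (intro finite_Lim_measure_incseq \<open>incseq U\<close>) (auto simp: U_def intro!: sets_cylinder_union)
  moreover have "measure cantor_measure (U L) \<le> r" for L
    unfolding U_def using card[of L] by (subst measure_strings[OF finite_strings]) auto
  ultimately show ?thesis by (auto intro: LIMSEQ_le_const2)
qed

lemma card_strings:
  "card {\<sigma>. length \<sigma> = L \<and> P \<sigma>} = (\<Sum>c<2 ^ Suc L. of_bool (length (str_of c) = L \<and> P (str_of c)))"
proof -
  have "str_code ` {\<sigma>. length \<sigma> = L \<and> P \<sigma>}
      = {..<2 ^ Suc L} \<inter> {c. length (str_of c) = L \<and> P (str_of c)}" (is "?A = ?B")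
  proof
    show "?A \<subseteq> ?B"
    proof
      fix c assume "c \<in> ?A"
      then obtain \<sigma> where \<sigma>: "c = str_code \<sigma>" "length \<sigma> = L" "P \<sigma>" by blast
      then have "c < 2 ^ Suc L" using str_code_less[of \<sigma>] by simp
      then show "c \<in> ?B" using \<sigma> by simp
    qed
    show "?B \<subseteq> ?A" by (auto intro: image_eqI[of _ _ "str_of _"])
  qed
  moreover have "inj_on str_code S" for S by (simp add: inj_on_def)
  ultimately have "card {\<sigma>. length \<sigma> = L \<and> P \<sigma>} = card ?B" by (metis card_image)
  then show ?thesis by (simp add: sum.If_cases of_bool_def)
qed

section \<open>Fans of splitting strings\<close>

definition splits :: "prog \<Rightarrow> bool list \<Rightarrow> bool list \<Rightarrow> nat \<Rightarrow> bool" where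
  "splits q \<sigma> \<tau> x \<longleftrightarrow> run q \<sigma> x \<noteq> 0 \<and> run q \<tau> x \<noteq> 0 \<and> run q \<sigma> x \<noteq> run q \<tau> x"

definition strand :: "nat \<Rightarrow> nat \<Rightarrow> bool list" where
  "strand m j = str_of (component (p2 m) j)"

text \<open>
  A number \<open>m\<close> codes a bound \<open>p1 m\<close> on the splitting positions together with the strings \<open>strand m j\<close>.
  A fan has more strands than there can be disjoint classes of measure above \<open>2\<^sup>-\<^sup>n\<close>.
\<close>

definition fan :: "prog \<Rightarrow> nat \<Rightarrow> nat \<Rightarrow> bool" where
  "fan q n m \<longleftrightarrow> (\<forall>j<Suc (2 ^ n). prefix (str_of n) (strand m j)
     \<and> (\<forall>i<j. \<exists>x<p1 m. splits q (strand m i) (strand m j) x))"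

text \<open>Minimality makes the fan unique while the predicate stays primitive recursive, so
  \<open>heavy\<close> and \<open>fan_test\<close> refer to the same fan.\<close>

definition first_fan :: "prog \<Rightarrow> nat \<Rightarrow> nat \<Rightarrow> bool" where
  "first_fan q n m \<longleftrightarrow> fan q n m \<and> (\<forall>k<m. \<not> fan q n k)"

text \<open>In a fan, the positions below \<open>p1 m\<close> include one where any two given
  strands split, so no oracle agrees with both. The bound keeps the relation primitive
  recursive.\<close>

definition agrees :: "prog \<Rightarrow> prog \<Rightarrow> nat \<Rightarrow> nat \<Rightarrow> bool list \<Rightarrow> bool" where
  "agrees p q m j \<sigma> \<longleftrightarrow>
     (\<forall>x<p1 m. run q (strand m j) x \<noteq> 0 \<longrightarrow> run p \<sigma> x = run q (strand m j) x)"

text \<open>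
  The witness \<open>u\<close> consists of a fan and of a string length at which the measure of the class is seen to
  exceed \<open>2\<^sup>-\<^sup>n\<close>.
\<close>

definition heavy :: "prog \<Rightarrow> prog \<Rightarrow> nat \<Rightarrow> nat \<Rightarrow> nat \<Rightarrow> bool" where
  "heavy p q n j u \<longleftrightarrow> first_fan q n (p1 u)
     \<and> 2 ^ p2 u < 2 ^ n * card {\<sigma>. length \<sigma> = p2 u \<and> agrees p q (p1 u) j \<sigma>}"

text \<open>By \<open>ex_light\<close> the minimum exists and is at most \<open>2 ^ n\<close>; it is
  0 if there is no fan.\<close>

definition light_index :: "prog \<Rightarrow> prog \<Rightarrow> nat \<Rightarrow> nat" where
  "light_index p q n = (LEAST j. \<not> (\<exists>u. heavy p q n j u))"

definition fan_extension :: "prog \<Rightarrow> prog \<Rightarrow> bool list \<Rightarrow> bool list" where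
  "fan_extension p q \<sigma> = (if \<exists>m. fan q (str_code \<sigma>) m
     then strand (LEAST m. fan q (str_code \<sigma>) m) (light_index p q (str_code \<sigma>)) else \<sigma>)"

text \<open>The fan is part of the enumerated condition, so an index of the class is computed from
  \<open>n\<close> and \<open>j\<close> without deciding whether a fan exists. If there is none, the
  class is empty.\<close>

definition fan_test :: "prog \<Rightarrow> prog \<Rightarrow> nat \<Rightarrow> nat \<Rightarrow> cantor set" where
  "fan_test p q n j = (\<Union>\<sigma>\<in>{\<sigma>. \<exists>m. first_fan q n m \<and> agrees p q m j \<sigma>}. cylinder \<sigma>)"

section \<open>Primitive recursiveness of the fan predicates\<close>

lemma pr_fan0: "primitive_recursive (\<lambda>t. of_bool (fan q (p1 t) (p2 t)))"
  unfolding fan_def splits_def strand_def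
  by (intro pr_intros pr_prefix pr_component pr_run)

lemmas pr_fan = pr_comp2[where F = "\<lambda>n m. of_bool (fan q n m)" for q, OF pr_fan0]

lemma pr_first_fan0: "primitive_recursive (\<lambda>t. of_bool (first_fan q (p1 t) (p2 t)))"
  unfolding first_fan_def by (intro pr_intros pr_fan)

lemmas pr_first_fan = pr_comp2[where F = "\<lambda>n m. of_bool (first_fan q n m)" for q, OF pr_first_fan0]

lemma pr_agrees:
  assumes "primitive_recursive f" "primitive_recursive g" "primitive_recursive h"
  shows "primitive_recursive (\<lambda>t. of_bool (agrees p q (f t) (g t) (str_of (h t))))"
proof -
  have "primitive_recursive (\<lambda>t. of_bool (agrees p q (p1 (p1 t)) (p2 (p1 t)) (str_of (p2 t))))"
    unfolding agrees_def strand_def by (intro pr_intros pr_component pr_run)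
  from pr_comp2[where F = "\<lambda>y c. of_bool (agrees p q (p1 y) (p2 y) (str_of c))", OF this
      pr_pair[OF assms(1,2)] assms(3)]
  show ?thesis by simp
qed

lemma pr_heavy:
  assumes "primitive_recursive f" "primitive_recursive g" "primitive_recursive h"
  shows "primitive_recursive (\<lambda>t. of_bool (heavy p q (f t) (g t) (h t)))"
proof -
  have "primitive_recursive (\<lambda>t. of_bool (heavy p q (p1 (p1 t)) (p2 (p1 t)) (p2 t)))"
    unfolding heavy_def card_strings by (intro pr_intros pr_first_fan pr_agrees pr_length)
  from pr_comp2[where F = "\<lambda>y c. of_bool (heavy p q (p1 y) (p2 y) c)", OF this
      pr_pair[OF assms(1,2)] assms(3)]
  show ?thesis by simp
qed

section \<open>Heavy and light classes\<close>

lemma first_fan_unique: "first_fan q n m \<Longrightarrow> first_fan q n m' \<Longrightarrow> m = m'"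
  unfolding first_fan_def by (metis linorder_neqE_nat)

lemma first_fan_Least:
  assumes "fan q n m"
  shows "first_fan q n (LEAST m. fan q n m)"
  unfolding first_fan_def using LeastI[of "fan q n", OF assms] not_less_Least by blast

lemma first_fan_eq_Least:
  assumes "first_fan q n m"
  shows "(LEAST m. fan q n m) = m"
  using first_fan_unique[OF first_fan_Least assms] assms by (auto simp: first_fan_def)

lemma agrees_mono: "agrees p q m j \<sigma> \<Longrightarrow> prefix \<sigma> \<tau> \<Longrightarrow> agrees p q m j \<tau>"
  unfolding agrees_def by (metis run_mono)

lemma fan_test_eq:
  assumes "first_fan q n m"
  shows "fan_test p q n j = (\<Union>\<sigma>\<in>Collect (agrees p q m j). cylinder \<sigma>)"
proof -
  have "{\<sigma>. \<exists>m. first_fan q n m \<and> agrees p q m j \<sigma>} = Collect (agrees p q m j)"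
    using assms first_fan_unique by blast
  then show ?thesis by (simp add: fan_test_def)
qed

lemma sets_fan_test: "fan_test p q n j \<in> sets cantor_measure"
  unfolding fan_test_def by (rule sets_cylinder_union)

lemma light_measure:
  assumes "\<not> (\<exists>u. heavy p q n j u)"
  shows "measure cantor_measure (fan_test p q n j) \<le> (1 / 2) ^ n"
proof (cases "\<exists>m. first_fan q n m")
  case True
  then obtain m where m: "first_fan q n m" by blast
  have "card {\<sigma>. length \<sigma> = L \<and> agrees p q m j \<sigma>} / 2 ^ L \<le> (1 / 2 :: real) ^ n" for L
  proof -
    have "\<not> heavy p q n j (prod_encode (m, L))" using assms by blast
    then have "2 ^ n * card {\<sigma>. length \<sigma> = L \<and> agrees p q m j \<sigma>} \<le> 2 ^ L"
      using m by (simp add: heavy_def)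
    then have "real (2 ^ n * card {\<sigma>. length \<sigma> = L \<and> agrees p q m j \<sigma>}) \<le> real (2 ^ L)"
      by (rule of_nat_mono)
    then show ?thesis by (simp add: field_simps power_one_over)
  qed
  then show ?thesis unfolding fan_test_eq[OF m]
    by (intro measure_open_le) (auto intro: agrees_mono)
next
  case False
  then show ?thesis by (simp add: fan_test_def)
qed

lemma heavy_measure:
  assumes "heavy p q n j u"
  shows "(1 / 2) ^ n < measure cantor_measure (fan_test p q n j)"
proof -
  define m L where "m = p1 u" and "L = p2 u"
  have m: "first_fan q n m" and lt: "2 ^ L < 2 ^ n * card {\<sigma>. length \<sigma> = L \<and> agrees p q m j \<sigma>}"
    using assms by (auto simp: heavy_def m_def L_def)
  from lt have "real (2 ^ L) < real (2 ^ n * card {\<sigma>. length \<sigma> = L \<and> agrees p q m j \<sigma>})"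
    by (rule of_nat_less_iff[THEN iffD2])
  then have "(1 / 2) ^ n < card {\<sigma>. length \<sigma> = L \<and> agrees p q m j \<sigma>} / (2 ^ L :: real)"
    by (simp add: field_simps power_one_over)
  also have "\<dots> \<le> measure cantor_measure (fan_test p q n j)"
    unfolding fan_test_eq[OF m] by (rule measure_open_ge)
  finally show ?thesis .
qed

text \<open>A common member would make \<open>p\<close> produce two different values at a position
  where the strands split.\<close>

lemma fan_test_disjoint:
  assumes m: "first_fan q n m" and "i < j" "j < Suc (2 ^ n)"
  shows "fan_test p q n i \<inter> fan_test p q n j = {}"
proof -
  have False if i: "agrees p q m i \<sigma>" and j: "agrees p q m j \<tau>"
    and Y: "Y \<in> cylinder \<sigma>" "Y \<in> cylinder \<tau>" for \<sigma> \<tau> Y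
  proof -
    obtain x where x: "x < p1 m" "splits q (strand m i) (strand m j) x"
      using assms unfolding first_fan_def fan_def by blast
    have \<sigma>: "\<sigma> = Y \<restriction> length \<sigma>" and \<tau>: "\<tau> = Y \<restriction> length \<tau>"
      using Y by (auto simp: cylinder_def)
    define \<rho> where "\<rho> = Y \<restriction> max (length \<sigma>) (length \<tau>)"
    have "prefix \<sigma> \<rho>" "prefix \<tau> \<rho>"
      unfolding \<rho>_def by (subst \<sigma> \<tau>, rule prefix_restr, simp)+
    then have "agrees p q m i \<rho>" "agrees p q m j \<rho>" using i j agrees_mono by blast+
    then show False using x unfolding agrees_def splits_def by metis
  qed
  then show ?thesis unfolding fan_test_eq[OF m] by blast
qed

text \<open>Otherwise \<open>2 ^ n + 1\<close> disjoint classes, each of measure above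
  \<open>(1 / 2) ^ n\<close>, would have total measure above 1.\<close>

lemma ex_light: "\<exists>j\<le>2 ^ n. \<not> (\<exists>u. heavy p q n j u)"
proof (rule ccontr)
  assume "\<not> ?thesis"
  then have h: "\<exists>u. heavy p q n j u" if "j < Suc (2 ^ n)" for j
    using that by (meson less_Suc_eq_le)
  obtain m where m: "first_fan q n m" using h[of 0] by (auto simp: heavy_def)
  interpret prob_space cantor_measure by (rule prob_space_cantor_measure)
  have "disjoint_family_on (fan_test p q n) {..<Suc (2 ^ n)}"
    unfolding disjoint_family_on_def
    using fan_test_disjoint[OF m] by (metis inf_commute lessThan_iff linorder_neqE_nat)
  then have "measure cantor_measure (\<Union>j<Suc (2 ^ n). fan_test p q n j)
      = (\<Sum>j<Suc (2 ^ n). measure cantor_measure (fan_test p q n j))"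
    by (intro finite_measure_finite_Union) (simp_all add: image_subset_iff sets_fan_test)
  moreover have "(\<Sum>j<Suc (2 ^ n). measure cantor_measure (fan_test p q n j))
      \<ge> (\<Sum>j<Suc (2 ^ n). (1 / 2) ^ n)"
    using h heavy_measure by (intro sum_mono) (meson less_imp_le lessThan_iff)
  moreover have "(\<Sum>j<Suc (2 ^ n). (1 / 2) ^ n) > (1 :: real)"
    by (simp add: power_one_over field_simps)
  ultimately show False using prob_le_1[of "\<Union>j<Suc (2 ^ n). fan_test p q n j"] by linarith
qed

lemma light_index_light: "\<not> (\<exists>u. heavy p q n (light_index p q n) u)"
  and heavy_below_light_index: "j < light_index p q n \<Longrightarrow> \<exists>u. heavy p q n j u"
  and light_index_le: "light_index p q n \<le> 2 ^ n"
proof -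
  let ?P = "\<lambda>j. \<not> (\<exists>u. heavy p q n j u)"
  obtain i where i: "i \<le> 2 ^ n" "?P i" using ex_light by blast
  show "?P (light_index p q n)" unfolding light_index_def by (rule LeastI[of ?P, OF i(2)])
  show "light_index p q n \<le> 2 ^ n"
    unfolding light_index_def using Least_le[of ?P, OF i(2)] i(1) by linarith
  show "\<exists>u. heavy p q n j u" if "j < light_index p q n"
    using not_less_Least[of j ?P] that unfolding light_index_def by blast
qed

lemma prefix_fan_extension: "prefix \<sigma> (fan_extension p q \<sigma>)"
proof (cases "\<exists>m. fan q (str_code \<sigma>) m")
  case True
  then have "fan q (str_code \<sigma>) (LEAST m. fan q (str_code \<sigma>) m)"
    using first_fan_Least first_fan_def by blast
  \<comment> \<open>The light index is at most \<open>2 ^ n\<close>, so it names one of the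
    \<open>2 ^ n + 1\<close> strands, all of which extend \<open>\<sigma>\<close>.\<close>
  then have "prefix (str_of (str_code \<sigma>))
      (strand (LEAST m. fan q (str_code \<sigma>) m) (light_index p q (str_code \<sigma>)))"
    using light_index_le[of p q "str_code \<sigma>"] unfolding fan_def[of q _ "Least _"] less_Suc_eq_le by blast
  then show ?thesis using True by (simp add: fan_extension_def)
qed (simp add: fan_extension_def)

section \<open>The Demuth test\<close>

text \<open>Each change is a strict increase, so the changing stages have different values, all of
  them below \<open>B\<close>.\<close>

lemma card_changes_mono:
  fixes f :: "nat \<Rightarrow> nat"
  assumes "mono f" "\<And>s. f s \<le> B"
  shows "finite {s. f s \<noteq> f (s + 1)} \<and> card {s. f s \<noteq> f (s + 1)} \<le> B"
proof -
  let ?C = "{s. f s \<noteq> f (s + 1)}"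
  have less: "f s < f t" if "s \<in> ?C" "s < t" for s t
  proof -
    have "f s < f (s + 1)" using monoD[OF assms(1), of s "s + 1"] that(1) by simp
    also have "\<dots> \<le> f t" using monoD[OF assms(1), of "s + 1" t] that(2) by simp
    finally show ?thesis .
  qed
  have inj: "inj_on f ?C"
    by (rule inj_onI) (metis less linorder_neqE_nat order_less_irrefl)
  have sub: "f ` ?C \<subseteq> {..<B}"
  proof
    fix y assume "y \<in> f ` ?C"
    then obtain s where "s \<in> ?C" "y = f s" by blast
    then show "y \<in> {..<B}" using less[of s "s + 1"] assms(2)[of "s + 1"] by simp
  qed
  have "finite ?C" using finite_imageD[OF finite_subset[OF sub] inj] by simp
  moreover have "card ?C \<le> B"
    using card_mono[OF _ sub] card_image[OF inj] by simp
  ultimately show ?thesis ..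
qed

lemma bleast_mono:
  assumes "\<And>i. Q i \<Longrightarrow> P i"
  shows "bleast P B \<le> bleast Q B"
  using bleast_cases[of Q B] not_less_bleast[of _ P B] bleast_le[of P B] assms
  by (metis linorder_not_less)

lemma demuth_test_fan: "demuth_test (\<lambda>n. fan_test p q n (light_index p q n))"
proof -
  have "primitive_recursive (\<lambda>t. of_bool (first_fan q (p1 (p1 t)) (p2 (p2 t))
      \<and> agrees p q (p2 (p2 t)) (p2 (p1 t)) (str_of (p1 (p2 t)))))"
    by (intro pr_intros pr_first_fan pr_agrees)
  then obtain g where g: "primitive_recursive g"
    "\<And>y. \<W> (g y) = (\<Union>\<sigma>\<in>{\<sigma>. \<exists>m. first_fan q (p1 y) m \<and> agrees p q m (p2 y) (str_of (str_code \<sigma>))}. cylinder \<sigma>)"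
    using eff_open_index[where R = "\<lambda>y c m. first_fan q (p1 y) m \<and> agrees p q m (p2 y) (str_of c)"]
    by blast
  have \<W>: "\<W> (g (prod_encode (n, j))) = fan_test p q n j" for n j
    by (simp add: g(2) fan_test_def)
  \<comment> \<open>The guess at stage \<open>s\<close> is the first class not yet seen to be heavy
    by a witness below \<open>s\<close>. It can only grow with \<open>s\<close>, and the default
    \<open>2 ^ n\<close> is itself the last index of a strand.\<close>
  define idx where "idx n s = bleast (\<lambda>j. \<not> (\<exists>u<s. heavy p q n j u)) (2 ^ n)" for n s
  define a where "a n s = g (prod_encode (n, idx n s))" for n s
  have "computable2 a"
    unfolding a_def idx_def
    by (intro primitive_recursive_computable2 pr_comp[OF g(1)] pr_intros pr_heavy)
  moreover have "computable (\<lambda>n. 2 ^ n)"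
    by (intro primitive_recursive_computable pr_intros)
  moreover have "\<forall>\<^sub>F s in sequentially. a n s = g (prod_encode (n, light_index p q n))" for n
  proof -
    have ev: "\<exists>L. \<forall>l\<ge>L. \<exists>u<l. heavy p q n j u" if j: "j < light_index p q n" for j
    proof -
      obtain u where "heavy p q n j u" using heavy_below_light_index[OF j] by blast
      then have "\<forall>l\<ge>Suc u. \<exists>u<l. heavy p q n j u" by (auto simp: Suc_le_eq)
      then show ?thesis by blast
    qed
    have "\<exists>L. \<forall>l\<ge>L. \<forall>j<light_index p q n. \<exists>u<l. heavy p q n j u"
      by (rule uniform_bound) (rule ev)
    then obtain L where L: "\<forall>l\<ge>L. \<forall>j<light_index p q n. \<exists>u<l. heavy p q n j u" by blast
    have "idx n s = light_index p q n" if "s \<ge> L" for s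
      unfolding idx_def using L that light_index_light[of p q n] light_index_le[of p q n]
      by (intro bleast_eqI) blast+
    then show ?thesis unfolding eventually_sequentially a_def by metis
  qed
  moreover have "finite {s. a n s \<noteq> a n (s + 1)} \<and> card {s. a n s \<noteq> a n (s + 1)} \<le> 2 ^ n" for n
  proof -
    have "mono (idx n)"
      unfolding idx_def by (intro monoI bleast_mono) (meson order_less_le_trans)
    moreover have "idx n s \<le> 2 ^ n" for s unfolding idx_def by (rule bleast_le)
    ultimately have c: "finite {s. idx n s \<noteq> idx n (s + 1)} \<and> card {s. idx n s \<noteq> idx n (s + 1)} \<le> 2 ^ n"
      by (rule card_changes_mono)
    have sub: "{s. a n s \<noteq> a n (s + 1)} \<subseteq> {s. idx n s \<noteq> idx n (s + 1)}"
      by (auto simp: a_def)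
    then show ?thesis using c finite_subset[OF sub] card_mono[OF _ sub] by linarith
  qed
  ultimately have "omega_ca (\<lambda>n. g (prod_encode (n, light_index p q n)))"
    unfolding omega_ca_def by blast
  then show ?thesis
    unfolding demuth_test_def using \<W> light_measure[OF light_index_light] by metis
qed

section \<open>The generic extension\<close>

text \<open>The oracle is asked only whether a fan exists and which classes are heavy. The fan
  itself is found by an unbounded search without queries, so its size does not enter the
  use.\<close>

lemma pb_computable_fan_extension: "pb_computable (fan_extension p q)"
proof -
  obtain h where h: "primitive_recursive h" "\<And>n. zero_jump (h n) \<longleftrightarrow> (\<exists>m. fan q n m)"
    using zero_jump_index[OF pr_fan0] by blast
  have "primitive_recursive (\<lambda>t. of_bool (heavy p q (p1 (p1 t)) (p2 (p1 t)) (p2 t)))"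
    by (intro pr_heavy pr_intros)
  then obtain k where k: "primitive_recursive k"
    "\<And>y. zero_jump (k y) \<longleftrightarrow> (\<exists>u. heavy p q (p1 y) (p2 y) u)"
    using zero_jump_index[where R = "\<lambda>y. heavy p q (p1 y) (p2 y)"] by blast
  obtain ph where ph: "\<And>A n. eval A ph n = Some (h n)" using primitive_recursive_progE[OF h(1)] by blast
  obtain pk where pk: "\<And>A y. eval A pk y = Some (k y)" using primitive_recursive_progE[OF k(1)] by blast
  \<comment> \<open>The first disjunct ends the search at once if the answer about the fan was
    negative, so the program is total.\<close>
  have "primitive_recursive (\<lambda>t. of_bool (p2 (p1 t) = 0 \<or> fan q (p1 (p1 t)) (p2 t)))"
    by (intro pr_intros pr_fan)
  then obtain ps where ps: "\<And>A t. eval A ps t = (if \<exists>m. p2 t = 0 \<or> fan q (p1 t) m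
      then Some (LEAST m. p2 t = 0 \<or> fan q (p1 t) m) else None)"
    using search_prog[where R = "\<lambda>t m. p2 t = 0 \<or> fan q (p1 t) m"] by blast
  \<comment> \<open>Here \<open>t\<close> packs \<open>n\<close> with the answer about the fan, then
    the light index and the fan. The output is the code of the chosen strand or, without a fan,
    \<open>n\<close>.\<close>
  have "primitive_recursive (\<lambda>t. if p2 (p1 t) = 0 then p1 (p1 t)
      else component (p2 (p2 (p2 t))) (p1 (p2 t)))"
    by (intro pr_intros pr_component)
  then obtain po where po: "\<And>A t. eval A po t = Some (if p2 (p1 t) = 0 then p1 (p1 t)
      else component (p2 (p2 (p2 t))) (p1 (p2 t)))"
    using primitive_recursive_progE by blast
  define qh qm where "qh = Tuple (Tuple Fst Snd) (Compose Query ph)" and "qm = Compose Query pk"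
  define P where "P = Compose po (Tuple qh (Tuple (Mu qm) (Compose ps qh)))"
  \<comment> \<open>The sum dominates every query about a class up to \<open>2 ^ n\<close>, and
    \<open>Suc\<close> makes the bound strict.\<close>
  define b where "b n = Suc (h n + (\<Sum>j<Suc (2 ^ n). k (prod_encode (n, j))))" for n
  have "primitive_recursive b"
    unfolding b_def by (intro pr_intros pr_comp[OF k(1)] pr_comp[OF h(1)])
  moreover have "eval (oracle_of zero_jump |` {..<b (str_code \<sigma>)}) P (str_code \<sigma>)
      = Some (str_code (fan_extension p q \<sigma>))" for \<sigma>
  proof -
    define n where "n = str_code \<sigma>"
    define A where "A = oracle_of zero_jump |` {..<b n}"
    have "h n < b n" by (simp add: b_def)
    then have H: "eval A qh n = Some (prod_encode (n, of_bool (\<exists>m. fan q n m)))"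
      by (simp add: qh_def ph A_def oracle_of_def h(2))
    have k_less: "k (prod_encode (n, j)) < b n" if "j \<le> 2 ^ n" for j
      using member_le_sum[of j "{..<Suc (2 ^ n)}" "\<lambda>j. k (prod_encode (n, j))"] that
      by (simp add: b_def less_Suc_eq_le del: sum.lessThan_Suc)
    have M: "eval A qm (prod_encode (n, j)) = Some (of_bool (\<exists>u. heavy p q n j u))" if "j \<le> 2 ^ n" for j
      using k_less[OF that] by (simp add: qm_def pk A_def oracle_of_def k(2))
    \<comment> \<open>The search stops at the light index, which is at most \<open>2 ^ n\<close>, so
      all its queries fall where the truncated oracle is defined.\<close>
    have I: "eval A (Mu qm) n = Some (light_index p q n)"
    proof -
      let ?i = "light_index p q n"
      have 0: "eval A qm (prod_encode (n, ?i)) = Some 0"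
        using M[OF light_index_le] light_index_light[of p q n] by simp
      have lt: "eval A qm (prod_encode (n, j)) = Some 1" if "j < ?i" for j
        using M[of j] heavy_below_light_index[OF that] light_index_le[of p q n] that by simp
      have "(LEAST j. eval A qm (prod_encode (n, j)) = Some 0) = ?i"
        using 0 lt by (intro Least_equality) (auto simp: not_less[symmetric])
      moreover have "\<exists>i. eval A qm (prod_encode (n, i)) = Some 0
          \<and> (\<forall>j<i. eval A qm (prod_encode (n, j)) \<noteq> None)"
        using 0 lt by (intro exI[of _ ?i]) simp
      ultimately show ?thesis by simp
    qed
    show ?thesis
    proof (cases "\<exists>m. fan q n m")
      case True
      then have "eval A P n = Some (component (p2 (LEAST m. fan q n m)) (light_index p q n))"
        using H I by (simp add: P_def ps po del: eval.simps(9))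
      then show ?thesis
        using True unfolding n_def A_def by (simp add: fan_extension_def strand_def)
    next
      case False
      then have "eval A P n = Some n"
        using H I by (simp add: P_def ps po del: eval.simps(9))
      then show ?thesis
        using False unfolding n_def A_def by (simp add: fan_extension_def)
    qed
  qed
  ultimately show ?thesis unfolding pb_computable_def by blast
qed

section \<open>Existence of fans\<close>

text \<open>Otherwise every convergent value above \<open>G \<restriction> k\<close> is correct, and
  searching for any convergent extension computes \<open>Z\<close> without an oracle.\<close>

lemma ex_wrong_extension:
  assumes q: "\<And>x. eval (oracle_of G) q x = Some (of_bool (Z x))"
    and "\<not> computable_seq Z"
  shows "\<exists>\<tau> x. prefix (G \<restriction> k) \<tau> \<and> run q \<tau> x \<noteq> 0 \<and> run q \<tau> x \<noteq> Suc (of_bool (Z x))"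
proof (rule ccontr)
  assume *: "\<not> ?thesis"
  define s where "s = str_code (G \<restriction> k)"
  let ?R = "\<lambda>x c. prefix (str_of s) (str_of c) \<and> run q (str_of c) x \<noteq> 0"
  have "primitive_recursive (\<lambda>t. of_bool (?R (p1 t) (p2 t)))"
    by (intro pr_intros pr_prefix pr_run)
  then obtain ps where ps: "\<And>A x. eval A ps x = (if \<exists>c. ?R x c then Some (LEAST c. ?R x c) else None)"
    using search_prog[where R = ?R] by blast
  have "primitive_recursive (\<lambda>t. run q (str_of (p2 t)) (p1 t) - 1)"
    by (intro pr_intros pr_run)
  then obtain po where po: "\<And>A t. eval A po t = Some (run q (str_of (p2 t)) (p1 t) - 1)"
    using primitive_recursive_progE by blast
  have "eval A (Compose po (Tuple (Tuple Fst Snd) ps)) x = Some (of_bool (Z x))" for A x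
  proof -
    obtain L where L: "\<forall>l\<ge>L. run q (G \<restriction> l) x = Suc (of_bool (Z x))"
      using run_converges[OF q] by blast
    \<comment> \<open>The search ends because long initial segments of \<open>G\<close> itself
      converge.\<close>
    have "?R x (str_code (G \<restriction> max k L))"
      using L by (simp add: s_def prefix_restr)
    then have ex: "\<exists>c. ?R x c" by blast
    then have "?R x (LEAST c. ?R x c)" by (rule LeastI_ex)
    then have "run q (str_of (LEAST c. ?R x c)) x = Suc (of_bool (Z x))"
      using * unfolding s_def str_of_str_code by blast
    then show ?thesis using ex by (simp add: ps po)
  qed
  then have "computable_seq Z" unfolding computable_seq_def computable_def by blast
  with assms(2) show False by contradiction
qed

text \<open>
  Each string of the family goes wrong about \<open>Z\<close> somewhere; a new one is found above a long initial
  segment of \<open>G\<close>, which gives the right values at all these places.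
\<close>

lemma ex_splitting_family:
  assumes q: "\<And>x. eval (oracle_of G) q x = Some (of_bool (Z x))"
    and Z: "\<not> computable_seq Z"
  shows "\<exists>ts. length ts = N
    \<and> (\<forall>j<N. prefix (G \<restriction> k) (ts ! j)
        \<and> (\<exists>x. run q (ts ! j) x \<noteq> 0 \<and> run q (ts ! j) x \<noteq> Suc (of_bool (Z x))))
    \<and> (\<forall>j<N. \<forall>i<j. \<exists>x. splits q (ts ! i) (ts ! j) x)"
proof (induction N)
  case (Suc N)
  then obtain ts where ts: "length ts = N" "\<forall>j<N. prefix (G \<restriction> k) (ts ! j)"
    "\<forall>j<N. \<exists>x. run q (ts ! j) x \<noteq> 0 \<and> run q (ts ! j) x \<noteq> Suc (of_bool (Z x))"
    "\<forall>j<N. \<forall>i<j. \<exists>x. splits q (ts ! i) (ts ! j) x" by auto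
  have ev: "\<exists>L. \<forall>l\<ge>L. \<exists>x. run q (ts ! j) x \<noteq> 0 \<and> run q (ts ! j) x \<noteq> run q (G \<restriction> l) x
      \<and> run q (G \<restriction> l) x \<noteq> 0" if j: "j < N" for j
  proof -
    obtain x where x: "run q (ts ! j) x \<noteq> 0" "run q (ts ! j) x \<noteq> Suc (of_bool (Z x))"
      using ts(3) j by blast
    obtain L where "\<forall>l\<ge>L. run q (G \<restriction> l) x = Suc (of_bool (Z x))"
      using run_converges[OF q] by blast
    then show ?thesis using x by (metis nat.distinct(1))
  qed
  have "\<exists>L. \<forall>l\<ge>L. \<forall>j<N. \<exists>x. run q (ts ! j) x \<noteq> 0 \<and> run q (ts ! j) x \<noteq> run q (G \<restriction> l) x
      \<and> run q (G \<restriction> l) x \<noteq> 0"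
    by (rule uniform_bound) (rule ev)
  then obtain L where
    L: "\<forall>l\<ge>L. \<forall>j<N. \<exists>x. run q (ts ! j) x \<noteq> 0 \<and> run q (ts ! j) x \<noteq> run q (G \<restriction> l) x
      \<and> run q (G \<restriction> l) x \<noteq> 0" by blast
  obtain \<tau> x where \<tau>: "prefix (G \<restriction> max k L) \<tau>" "run q \<tau> x \<noteq> 0" "run q \<tau> x \<noteq> Suc (of_bool (Z x))"
    using ex_wrong_extension[OF q Z] by blast
  have pre: "prefix (G \<restriction> k) \<tau>"
    using prefix_restr[of k "max k L" G] \<tau>(1) by (meson max.cobounded1 prefix_order.trans)
  have new: "\<exists>x. splits q (ts ! j) \<tau> x" if j: "j < N" for j
  proof -
    obtain y where "run q (ts ! j) y \<noteq> 0" "run q (ts ! j) y \<noteq> run q (G \<restriction> max k L) y"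
      "run q (G \<restriction> max k L) y \<noteq> 0" using L j max.cobounded2 by blast
    then show ?thesis unfolding splits_def using run_mono[OF \<tau>(1)] by metis
  qed
  have "(ts @ [\<tau>]) ! j = ts ! j" if "j < N" for j using ts(1) that by (simp add: nth_append)
  moreover have "(ts @ [\<tau>]) ! N = \<tau>" using ts(1) by (metis nth_append_length)
  ultimately show ?case using ts \<tau> pre new
    by (intro exI[of _ "ts @ [\<tau>]"]) (auto simp: less_Suc_eq)
qed simp

lemma ex_fan:
  assumes q: "\<And>x. eval (oracle_of G) q x = Some (of_bool (Z x))"
    and Z: "\<not> computable_seq Z"
  shows "\<exists>m. fan q (str_code (G \<restriction> k)) m"
proof -
  define n N where "n = str_code (G \<restriction> k)" and "N = Suc (2 ^ n)"
  obtain ts where ts: "length ts = N" "\<forall>j<N. prefix (G \<restriction> k) (ts ! j)"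
    "\<forall>j<N. \<forall>i<j. \<exists>x. splits q (ts ! i) (ts ! j) x"
    using ex_splitting_family[OF q Z, of N k] by blast
  have ev: "\<exists>L. \<forall>l\<ge>L. \<forall>i<j. \<exists>x<l. splits q (ts ! i) (ts ! j) x" if j: "j < N" for j
  proof (rule uniform_bound)
    fix i assume "i < j"
    then obtain x where "splits q (ts ! i) (ts ! j) x" using ts(3) j by blast
    then have "\<forall>l\<ge>Suc x. \<exists>x<l. splits q (ts ! i) (ts ! j) x" by (auto simp: Suc_le_eq)
    then show "\<exists>L. \<forall>l\<ge>L. \<exists>x<l. splits q (ts ! i) (ts ! j) x" by blast
  qed
  \<comment> \<open>A common bound on the splitting positions becomes the first component of the
    fan; the second one codes the strings.\<close>
  have "\<exists>L. \<forall>l\<ge>L. \<forall>j<N. \<forall>i<j. \<exists>x<l. splits q (ts ! i) (ts ! j) x"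
    by (rule uniform_bound) (rule ev)
  then obtain l where
    l: "\<forall>j<N. \<forall>i<j. \<exists>x<l. splits q (ts ! i) (ts ! j) x" by blast
  obtain w where "\<forall>j<N. component w j = map str_code ts ! j"
    using component_surj[of "map str_code ts"] ts(1) by auto
  then have strand: "strand (prod_encode (l, w)) j = ts ! j" if "j < N" for j
    using that ts(1) by (simp add: strand_def)
  have "fan q n (prod_encode (l, w))"
    unfolding fan_def N_def[symmetric]
  proof (intro allI impI conjI)
    fix j assume j: "j < N"
    show "prefix (str_of n) (strand (prod_encode (l, w)) j)"
      using ts(2) j by (simp add: strand n_def)
    fix i assume "i < j"
    then show "\<exists>x<p1 (prod_encode (l, w)). splits q (strand (prod_encode (l, w)) i) (strand (prod_encode (l, w)) j) x"
      using l j strand[of i] strand[of j] by simp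
  qed
  then show ?thesis unfolding n_def by blast
qed

text \<open>Different initial segments give different test indices, so infinitely many successes of
  \<open>G\<close> reach infinitely many members of the test.\<close>

lemma str_code_restr_inj: "inj (\<lambda>k. str_code (G \<restriction> k))"
  by (rule injI) (metis length_restr str_code_inj)

section \<open>Common lower bounds of a Demuth random and a pb-generic sequence\<close>

lemma common_lower_bound_computable:
  assumes "demuth_random X" "pb_generic G" "Z \<le>\<^sub>T X" "Z \<le>\<^sub>T G"
  shows "computable_seq Z"
proof (rule ccontr)
  assume Z: "\<not> computable_seq Z"
  obtain p where p: "\<And>x. eval (oracle_of X) p x = Some (of_bool (Z x))"
    using assms(3) unfolding turing_le_def by blast
  obtain q where q: "\<And>x. eval (oracle_of G) q x = Some (of_bool (Z x))"
    using assms(4) unfolding turing_le_def by blast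
  let ?K = "{k. G \<in> cylinder (fan_extension p q (G \<restriction> k))}"
  have "infinite ?K"
    using assms(2) pb_computable_fan_extension prefix_fan_extension unfolding pb_generic_def by blast
  have "X \<in> fan_test p q (str_code (G \<restriction> k)) (light_index p q (str_code (G \<restriction> k)))"
    if k: "k \<in> ?K" for k
  proof -
    define n where "n = str_code (G \<restriction> k)"
    obtain m where m: "first_fan q n m"
      using ex_fan[OF q Z, of k] first_fan_Least unfolding n_def by blast
    define \<tau> where "\<tau> = strand m (light_index p q n)"
    have "fan_extension p q (G \<restriction> k) = \<tau>"
      using m first_fan_eq_Least[OF m] by (auto simp: fan_extension_def n_def \<tau>_def first_fan_def)
    then have \<tau>: "\<tau> = G \<restriction> length \<tau>" using k by (simp add: cylinder_def)
    \<comment> \<open>As \<open>\<tau>\<close> is an initial segment of \<open>G\<close>, its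
      convergent values under \<open>q\<close> are values of \<open>Z\<close>, which
      \<open>p\<close> also computes from \<open>X\<close>.\<close>
    have ev: "\<exists>L. \<forall>l\<ge>L. run q \<tau> x \<noteq> 0 \<longrightarrow> run p (X \<restriction> l) x = run q \<tau> x" for x
    proof -
      have "run q \<tau> x \<noteq> 0 \<Longrightarrow> run q \<tau> x = Suc (of_bool (Z x))"
        using run_value[OF q, of "length \<tau>"] \<tau> by metis
      then show ?thesis using run_converges[OF p, of x] by metis
    qed
    have "\<exists>L. \<forall>l\<ge>L. \<forall>x<p1 m. run q \<tau> x \<noteq> 0 \<longrightarrow> run p (X \<restriction> l) x = run q \<tau> x"
      by (rule uniform_bound) (rule ev)
    then obtain L
      where "\<forall>x<p1 m. run q \<tau> x \<noteq> 0 \<longrightarrow> run p (X \<restriction> L) x = run q \<tau> x" by blast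
    then have "agrees p q m (light_index p q n) (X \<restriction> L)"
      by (simp add: agrees_def \<tau>_def)
    then show ?thesis
      unfolding n_def[symmetric] fan_test_eq[OF m] using in_cylinder_restr by blast
  qed
  then have "(\<lambda>k. str_code (G \<restriction> k)) ` ?K \<subseteq> {n. X \<in> fan_test p q n (light_index p q n)}" by blast
  moreover have "finite {n. X \<in> fan_test p q n (light_index p q n)}"
    using assms(1) demuth_test_fan unfolding demuth_random_def by blast
  ultimately have "finite ((\<lambda>k. str_code (G \<restriction> k)) ` ?K)" by (metis finite_subset)
  then have "finite ?K" by (rule finite_imageD[OF _ inj_on_subset[OF str_code_restr_inj subset_UNIV]])
  with \<open>infinite ?K\<close> show False by contradiction
qed

section \<open>Noncomputability\<close>

text \<open>The cylinders around a computable \<open>X\<close> form a Demuth test with a constant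
  approximation, and \<open>X\<close> lies in all of them.\<close>

lemma demuth_random_noncomputable:
  assumes "demuth_random X"
  shows "\<not> computable_seq X"
proof
  assume "computable_seq X"
  then obtain p where p: "\<And>x. eval empty_oracle p x = Some (of_bool (X x))"
    unfolding computable_seq_def computable_def by blast
  \<comment> \<open>The string of \<open>s\<close> zeros stands for the empty oracle and also bounds
    the computation, so \<open>s\<close> serves as the stage.\<close>
  define zeros :: "nat \<Rightarrow> nat" where "zeros s = rec_nat 0 (\<lambda>_ r. 2 * r + 1) s" for s
  have zeros: "zeros s = str_code ((\<lambda>_. False) \<restriction> s)" for s
    by (induction s) (simp_all add: zeros_def restr_def)
  let ?R = "\<lambda>n c s. length (str_of c) = n \<and>
    (\<forall>x<n. run p (str_of (zeros s)) x = Suc (of_bool (x < length (str_of c) \<and> str_of c ! x)))"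
  have "primitive_recursive (\<lambda>t. of_bool (?R (p1 t) (p1 (p2 t)) (p2 (p2 t))))"
    unfolding zeros_def by (intro pr_intros pr_run pr_nth pr_length)
  then obtain g where g: "primitive_recursive g"
    "\<And>n. \<W> (g n) = (\<Union>\<sigma>\<in>{\<sigma>. \<exists>s. ?R n (str_code \<sigma>) s}. cylinder \<sigma>)"
    using eff_open_index[where R = ?R] by blast
  have R: "(\<exists>s. ?R n (str_code \<sigma>) s) \<longleftrightarrow> \<sigma> = X \<restriction> n" for n \<sigma>
  proof
    assume "\<exists>s. ?R n (str_code \<sigma>) s"
    then obtain s where s: "length \<sigma> = n"
      "\<forall>x<n. run p ((\<lambda>_. False) \<restriction> s) x = Suc (of_bool (x < length \<sigma> \<and> \<sigma> ! x))"
      unfolding zeros str_of_str_code by blast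
    have "\<sigma> ! x = X x" if "x < n" for x
      using run_value[OF p, of s x] s that by (cases "\<sigma> ! x"; cases "X x") auto
    then show "\<sigma> = X \<restriction> n" using s(1) by (intro nth_equalityI) auto
  next
    assume \<sigma>: "\<sigma> = X \<restriction> n"
    have "\<exists>L. \<forall>l\<ge>L. \<forall>x<n. run p ((\<lambda>_. False) \<restriction> l) x = Suc (of_bool (X x))"
      by (rule uniform_bound) (rule run_converges[OF p])
    then obtain L where "\<forall>l\<ge>L. \<forall>x<n. run p ((\<lambda>_. False) \<restriction> l) x = Suc (of_bool (X x))"
      by blast
    then have "?R n (str_code \<sigma>) L" using \<sigma> by (simp add: zeros)
    then show "\<exists>s. ?R n (str_code \<sigma>) s" by blast
  qed
  have \<W>: "\<W> (g n) = cylinder (X \<restriction> n)" for n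
    unfolding g(2) R by simp
  have "computable2 (\<lambda>n s. g n)"
    by (intro primitive_recursive_computable2 pr_comp[OF g(1)] pr_intros)
  moreover have "computable (\<lambda>n. 0)" by (intro primitive_recursive_computable pr_const)
  ultimately have "omega_ca g"
    unfolding omega_ca_def by (intro exI[of _ "\<lambda>n s. g n"] exI[of _ "\<lambda>n. 0"]) simp
  then have "demuth_test (\<lambda>n. cylinder (X \<restriction> n))"
    unfolding demuth_test_def using \<W> by (auto simp: measure_cylinder)
  then have "finite {n. X \<in> cylinder (X \<restriction> n)}"
    using assms unfolding demuth_random_def by blast
  then show False by (simp add: in_cylinder_restr)
qed

text \<open>Queries are replaced by the answer 0 of the empty oracle, so that a program for a
  computable sequence runs under any oracle, even an undefined one.\<close>

primrec silence :: "prog \<Rightarrow> prog" where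
  "silence Zero = Zero"
| "silence Succ = Succ"
| "silence Fst = Fst"
| "silence Snd = Snd"
| "silence Query = Zero"
| "silence (Tuple p q) = Tuple (silence p) (silence q)"
| "silence (Compose p q) = Compose (silence p) (silence q)"
| "silence (PrimRec p q) = PrimRec (silence p) (silence q)"
| "silence (Mu p) = Mu (silence p)"

lemma eval_silence: "eval A (silence p) = eval empty_oracle p"
proof (induction p)
  case Query
  show ?case by (simp add: oracle_of_def fun_eq_iff)
qed (simp_all cong: if_cong)

text \<open>For a computable \<open>G\<close>, appending the bit opposite to that of
  \<open>G\<close> is an extension function computed without queries, and \<open>G\<close> never
  extends its values on initial segments of \<open>G\<close>.\<close>

lemma pb_generic_noncomputable:
  assumes "pb_generic G"
  shows "\<not> computable_seq G"
proof
  assume "computable_seq G"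
  then obtain p where p: "\<And>x. eval empty_oracle p x = Some (of_bool (G x))"
    unfolding computable_seq_def computable_def by blast
  define f where "f \<sigma> = \<sigma> @ [\<not> G (length \<sigma>)]" for \<sigma>
  obtain pl where pl: "\<And>A n. eval A pl n = Some (length (str_of n))"
    using primitive_recursive_progE[OF pr_length[OF pr_id]] by blast
  \<comment> \<open>The appended bit negates the value \<open>p2 t\<close>, so by
    \<open>str_code_snoc\<close> it contributes 2 if the value is 0 and 1 if it is 1.\<close>
  have "primitive_recursive (\<lambda>t. 2 * p1 t + (2 - p2 t))" by (intro pr_intros)
  then obtain po where po: "\<And>A t. eval A po t = Some (2 * p1 t + (2 - p2 t))"
    using primitive_recursive_progE by blast
  define P where "P = Compose po (Tuple (Tuple Fst Snd) (Compose (silence p) pl))"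
  have "eval A P (str_code \<sigma>) = Some (str_code (f \<sigma>))" for A \<sigma>
    by (simp add: P_def pl po eval_silence p f_def)
  moreover have "primitive_recursive (\<lambda>n. 0)" by (rule pr_const)
  ultimately have "pb_computable f" unfolding pb_computable_def by blast
  moreover have "prefix \<sigma> (f \<sigma>)" for \<sigma> by (simp add: f_def)
  ultimately have "infinite {n. G \<in> cylinder (f (G \<restriction> n))}"
    using assms unfolding pb_generic_def by blast
  then obtain n where "G \<in> cylinder (f (G \<restriction> n))" using not_finite_existsD by blast
  then have "\<forall>i<length (f (G \<restriction> n)). G i = f (G \<restriction> n) ! i"
    unfolding cylinder_def restr_eq_iff by blast
  moreover have "n < length (f (G \<restriction> n))" by (simp add: f_def)
  ultimately have "G n \<longleftrightarrow> f (G \<restriction> n) ! n" by blast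
  moreover have "f (G \<restriction> n) ! n \<longleftrightarrow> \<not> G n" by (simp add: f_def nth_append)
  ultimately show False by blast
qed

theorem theorem3p4:
  fixes X G :: "nat \<Rightarrow> bool"
  assumes "demuth_random X" and "pb_generic G"
  shows "minimal_pair X G"
  unfolding minimal_pair_def
  using assms demuth_random_noncomputable pb_generic_noncomputable
    common_lower_bound_computable[OF assms]
  by blast

end
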